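(* Let $\mathcal{D}\subseteq\mathbb{R}^d$ be a convex decision set with $\max_{\boldsymbol x,\boldsymbol y\in\mathcal{D}}\|\boldsymbol x-\boldsymbol y\|\le D$, and let $f_1,\ldots,f_T:\mathcal{D}\to\mathbb{R}$ be $\alpha$-exp-concave losses satisfying $|f_t(\boldsymbol x)-f_t(\boldsymbol y)|\le G\|\boldsymbol x-\boldsymbol y\|$ for all $\boldsymbol x,\boldsymbol y\in\mathcal{D}$. Run FLH with learning rate $\zeta=\alpha$ where the base learner $E^j$ is an instance of the Online Newton Step (ONS) algorithm started at time $j$. Then for every comparator sequence $\boldsymbol z_1,\ldots,\boldsymbol z_T\in\mathcal{D}$, $$\sum_{t=1}^T\big(f_t(\boldsymbol x_t)-f_t(\boldsymbol z_t)\big)=\tilde O\big(\sqrt{dTV_T}\vee d\big),$$ where $V_T=\sum_{t=2}^T\|\boldsymbol z_t-\boldsymbol z_{t-1}\|$ and $\tilde O$ hides dependence on $G,D,\alpha$ and polylogarithmic factors of $T$. The algorithm does not need to know $V_T$.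
   Context: $f$ is $\alpha$-exp-concave on $\mathcal{D}$ if $f(\boldsymbol y)\ge f(\boldsymbol x)+(\boldsymbol y-\boldsymbol x)^T\nabla f(\boldsymbol x)+\frac\alpha2\big((\boldsymbol y-\boldsymbol x)^T\nabla f(\boldsymbol x)\big)^2$ for all $\boldsymbol x,\boldsymbol y\in\mathcal{D}$. $a\vee b=\max\{a,b\}$. The learner plays $\boldsymbol x_t\in\mathcal{D}$ then observes $f_t$. FLH with learning rate $\zeta$ and base learners $E^1,\ldots,E^T$: maintain a probability vector $v_t\in\mathbb{R}^t$ with $v_1^{(1)}=1$; at round $t$ let $x_t^{(j)}$ be the prediction of $E^j$ for $j\le t$ and play $x_t=\sum_{j=1}^t v_t^{(j)}x_t^{(j)}$; after observing $f_t$ set $\hat v_{t+1}^{(i)}=v_t^{(i)}e^{-\zeta f_t(x_t^{(i)})}/\sum_{j=1}^t v_t^{(j)}e^{-\zeta f_t(x_t^{(j)})}$ for $i\le t$, then $v_{t+1}^{(t+1)}=1/(t+1)$ and $v_{t+1}^{(i)}=(1-(t+1)^{-1})\hat v_{t+1}^{(i)}$ for $i\le t$. ONS is the Online Newton Step algorithm of Hazan, Agarwal and Kale (2007), which has $O(d\log T)$ static regret under these assumptions. *)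

theory Defs
  imports "HOL-Analysis.Analysis"
begin

text \<open>Vectors of R^d are represented as functions nat => real that vanish at
coordinates >= d (so that the dimension d can be quantified inside the statement).
On this subspace the product topology on nat => real coincides with the Euclidean one.\<close>

type_synonym vect = "nat \<Rightarrow> real"

definition rspace :: "nat \<Rightarrow> vect set" where
  "rspace d = {x. \<forall>i\<ge>d. x i = 0}"

definition inn :: "nat \<Rightarrow> vect \<Rightarrow> vect \<Rightarrow> real" where
  "inn d x y = (\<Sum>i<d. x i * y i)"

definition vnorm :: "nat \<Rightarrow> vect \<Rightarrow> real" where
  "vnorm d x = sqrt (inn d x x)"

definition vdiff :: "vect \<Rightarrow> vect \<Rightarrow> vect" where
  "vdiff x y = (\<lambda>i. x i - y i)"

definition vscale :: "real \<Rightarrow> vect \<Rightarrow> vect" where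
  "vscale c x = (\<lambda>i. c * x i)"

definition convex_set :: "vect set \<Rightarrow> bool" where
  "convex_set S \<longleftrightarrow> (\<forall>x\<in>S. \<forall>y\<in>S. \<forall>u::real. 0 \<le> u \<and> u \<le> 1 \<longrightarrow>
      (\<lambda>i. u * x i + (1 - u) * y i) \<in> S)"

definition has_grad :: "nat \<Rightarrow> (vect \<Rightarrow> real) \<Rightarrow> vect \<Rightarrow> vect \<Rightarrow> bool" where
  "has_grad d f v x \<longleftrightarrow> v \<in> rspace d \<and>
     (\<forall>e>0. \<exists>\<delta>>0. \<forall>y\<in>rspace d. vnorm d (vdiff y x) < \<delta> \<longrightarrow>
        \<bar>f y - f x - inn d v (vdiff y x)\<bar> \<le> e * vnorm d (vdiff y x))"

definition exp_concave :: "nat \<Rightarrow> real \<Rightarrow> vect set \<Rightarrow> (vect \<Rightarrow> real) \<Rightarrow> (vect \<Rightarrow> vect) \<Rightarrow> bool" where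
  "exp_concave d \<alpha> D f gr \<longleftrightarrow> (\<forall>x\<in>D. \<forall>y\<in>D.
      f y \<ge> f x + inn d (vdiff y x) (gr x) + \<alpha> / 2 * (inn d (vdiff y x) (gr x))\<^sup>2)"

text \<open>ONS (Hazan, Agarwal, Kale 2007) with parameters
  gamma = 1/2 min(1/(4GD), alpha), eps = 1/(gamma^2 D^2).\<close>
definition ons_gamma :: "real \<Rightarrow> real \<Rightarrow> real \<Rightarrow> real" where
  "ons_gamma G Dd \<alpha> = 1/2 * min (1 / (4 * G * Dd)) \<alpha>"

definition ons_eps :: "real \<Rightarrow> real \<Rightarrow> real \<Rightarrow> real" where
  "ons_eps G Dd \<alpha> = 1 / ((ons_gamma G Dd \<alpha>)\<^sup>2 * Dd\<^sup>2)"

text \<open>The matrix A = eps I + sum of grad grad^T, as a linear map, and its quadratic form.\<close>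
definition Amap :: "nat \<Rightarrow> real \<Rightarrow> vect list \<Rightarrow> vect \<Rightarrow> vect" where
  "Amap d \<epsilon> gs v = (\<lambda>i. \<epsilon> * v i + (\<Sum>gv\<leftarrow>gs. inn d gv v * gv i))"

definition qform :: "nat \<Rightarrow> real \<Rightarrow> vect list \<Rightarrow> vect \<Rightarrow> real" where
  "qform d \<epsilon> gs v = inn d v (Amap d \<epsilon> gs v)"

text \<open>One ONS step from prediction p with past gradients gs (including the current one gt):
  y = p - (1/gamma) A^{-1} gt, then generalized projection onto D in the norm induced by A.\<close>
definition ons_step :: "nat \<Rightarrow> vect set \<Rightarrow> real \<Rightarrow> real \<Rightarrow> vect list \<Rightarrow> vect \<Rightarrow> vect \<Rightarrow> vect" where
  "ons_step d D \<gamma> \<epsilon> gs gt p =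
     (let y = (THE y. y \<in> rspace d \<and> Amap d \<epsilon> gs (vdiff p y) = vscale (1/\<gamma>) gt)
      in (SOME x. x \<in> D \<and> (\<forall>x'\<in>D. qform d \<epsilon> gs (vdiff y x) \<le> qform d \<epsilon> gs (vdiff y x'))))"

text \<open>ons_hist d D gr \<gamma> \<epsilon> x0 j n : the predictions of the ONS instance E^j started at time j
  with initial point x0, valid at times s in {j..j+n}. gr t x is the gradient of f_t at x.\<close>
primrec ons_hist :: "nat \<Rightarrow> vect set \<Rightarrow> (nat \<Rightarrow> vect \<Rightarrow> vect) \<Rightarrow> real \<Rightarrow> real \<Rightarrow> vect \<Rightarrow> nat \<Rightarrow> nat \<Rightarrow> (nat \<Rightarrow> vect)" where
  "ons_hist d D gr \<gamma> \<epsilon> x0 j 0 = (\<lambda>s. x0)"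
| "ons_hist d D gr \<gamma> \<epsilon> x0 j (Suc n) =
     (let h = ons_hist d D gr \<gamma> \<epsilon> x0 j n; t = j + n;
          gs = map (\<lambda>s. gr s (h s)) [j..<Suc t]
      in h(Suc t := ons_step d D \<gamma> \<epsilon> gs (gr t (h t)) (h t)))"

definition ons_pred :: "nat \<Rightarrow> vect set \<Rightarrow> (nat \<Rightarrow> vect \<Rightarrow> vect) \<Rightarrow> real \<Rightarrow> real \<Rightarrow> vect \<Rightarrow> nat \<Rightarrow> nat \<Rightarrow> vect" where
  "ons_pred d D gr \<gamma> \<epsilon> x0 j t = ons_hist d D gr \<gamma> \<epsilon> x0 j (t - j) t"

text \<open>FLH weights v_t (t >= 1), with base-learner predictions P j t and losses f t.
  flh_w \<zeta> f P t i = v_t^{(i)} for 1 <= i <= t.\<close>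
fun flh_w :: "real \<Rightarrow> (nat \<Rightarrow> vect \<Rightarrow> real) \<Rightarrow> (nat \<Rightarrow> nat \<Rightarrow> vect) \<Rightarrow> nat \<Rightarrow> nat \<Rightarrow> real" where
  "flh_w \<zeta> f P 0 = (\<lambda>i. 0)"
| "flh_w \<zeta> f P (Suc 0) = (\<lambda>i. if i = 1 then 1 else 0)"
| "flh_w \<zeta> f P (Suc (Suc n)) =
     (let t = Suc n; v = flh_w \<zeta> f P t;
          Z = (\<Sum>j=1..t. v j * exp (- \<zeta> * f t (P j t)))
      in (\<lambda>i. if 1 \<le> i \<and> i \<le> t then (1 - 1 / real (t + 1)) * (v i * exp (- \<zeta> * f t (P i t)) / Z)
              else if i = t + 1 then 1 / real (t + 1) else 0))"

definition flh_play :: "real \<Rightarrow> (nat \<Rightarrow> vect \<Rightarrow> real) \<Rightarrow> (nat \<Rightarrow> nat \<Rightarrow> vect) \<Rightarrow> nat \<Rightarrow> vect" where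
  "flh_play \<zeta> f P t = (\<lambda>i. \<Sum>j=1..t. flh_w \<zeta> f P t j * P j t i)"

definition flh_ons_play :: "nat \<Rightarrow> vect set \<Rightarrow> real \<Rightarrow> real \<Rightarrow> real \<Rightarrow> (nat \<Rightarrow> vect \<Rightarrow> real)
    \<Rightarrow> (nat \<Rightarrow> vect \<Rightarrow> vect) \<Rightarrow> (nat \<Rightarrow> vect) \<Rightarrow> nat \<Rightarrow> vect" where
  "flh_ons_play d D G Dd \<alpha> f gr x0 t =
     flh_play \<alpha> f (\<lambda>j t. ons_pred d D gr (ons_gamma G Dd \<alpha>) (ons_eps G Dd \<alpha>) (x0 j) j t) t"

end

theory Submission
  imports Defs
begin

text \<open>
  The quadratic lower bound makes \<open>exp (- \<alpha> * f t)\<close> concave, so one FLH round loses at most the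
  log-partition value. As \<open>t * v_t\<close> telescopes, FLH loses at most \<open>ln (r + 1) / \<alpha>\<close> against \<open>E^j\<close>
  on \<open>{j..r}\<close>. ONS started at \<open>j\<close> has static regret \<open>O(d log T)\<close> there, so FLH has regret
  \<open>O(d log T)\<close> on every interval against every fixed point. Cutting \<open>{1..T}\<close> into blocks and
  comparing with the first comparator of each block costs an additional \<open>G\<close> times the block length
  times the path length.

  The bound on the ONS regret usually goes through \<open>log det\<close>. Here the determinant is replaced by the
  pivots \<open>s_k\<close> of the quadratic form, the minimum of the form over vectors with \<open>k\<close>-th entry 1 and
  later entries 0: adding \<open>h h^T\<close> to the form increases \<open>ln s_k\<close> by at least \<open>(h \<bullet> v_k)^2 / s_k\<close>, with
  \<open>v_k\<close> the minimizer of the new form and \<open>s_k\<close> its new pivot, and the \<open>v_k\<close> are conjugate.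
\<close>

subsection \<open>Linear algebra in coordinates\<close>

text \<open>Differences and multiples of vectors are special cases, so one linearity rule per
  argument of each form suffices throughout.\<close>

definition lcomb :: "real \<Rightarrow> vect \<Rightarrow> real \<Rightarrow> vect \<Rightarrow> vect" where
  "lcomb a x b y = (\<lambda>i. a * x i + b * y i)"

definition unit_vec :: "nat \<Rightarrow> vect" where
  "unit_vec k = (\<lambda>i. if i = k then 1 else 0)"

lemma inn_commute: "inn d x y = inn d y x"
  by (simp add: inn_def mult.commute)

lemma inn_lcomb_left: "inn d (lcomb a x b y) z = a * inn d x z + b * inn d y z"
  by (simp add: inn_def lcomb_def sum.distrib sum_distrib_left algebra_simps)

lemma inn_lcomb_right: "inn d z (lcomb a x b y) = a * inn d z x + b * inn d z y"
  by (metis inn_commute inn_lcomb_left)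

lemma vdiff_eq_lcomb: "vdiff x y = lcomb 1 x (-1) y"
  by (simp add: vdiff_def lcomb_def)

lemma vscale_eq_lcomb: "vscale c x = lcomb c x 0 x"
  by (simp add: vscale_def lcomb_def)

lemma inn_sum_left: "inn d (\<lambda>i. \<Sum>k\<in>K. c k * v k i) y = (\<Sum>k\<in>K. c k * inn d (v k) y)"
  unfolding inn_def
  by (simp add: sum_distrib_left sum_distrib_right mult.assoc, subst sum.swap, simp)

lemma inn_self_nonneg: "inn d x x \<ge> 0"
  by (simp add: inn_def sum_nonneg)

lemma component_sq_le_inn:
  assumes "k < d" shows "(x k)\<^sup>2 \<le> inn d x x"
proof -
  have "x k * x k \<le> (\<Sum>i<d. x i * x i)"
    by (rule member_le_sum) (use assms in auto)
  then show ?thesis by (simp add: inn_def power2_eq_square)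
qed

lemma inn_unit_vec: "k < d \<Longrightarrow> inn d x (unit_vec k) = x k"
  by (simp add: inn_def unit_vec_def if_distrib cong: if_cong)

lemma vnorm_eq_L2_set: "vnorm d x = L2_set x {..<d}"
  by (simp add: vnorm_def inn_def L2_set_def power2_eq_square)

lemma vnorm_nonneg: "vnorm d x \<ge> 0"
  by (simp add: vnorm_def inn_self_nonneg)

lemma vnorm_sq: "(vnorm d x)\<^sup>2 = inn d x x"
  by (simp add: vnorm_def inn_self_nonneg)

lemma vnorm_vscale: "vnorm d (vscale c x) = \<bar>c\<bar> * vnorm d x"
proof -
  have "inn d (vscale c x) (vscale c x) = c\<^sup>2 * inn d x x"
    by (simp add: vscale_eq_lcomb inn_lcomb_left inn_lcomb_right power2_eq_square)
  then show ?thesis by (simp add: vnorm_def real_sqrt_mult)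
qed

lemma vnorm_vdiff_commute: "vnorm d (vdiff x y) = vnorm d (vdiff y x)"
  by (simp add: vnorm_def inn_def vdiff_def algebra_simps)

lemma vnorm_vdiff_triangle: "vnorm d (vdiff x z) \<le> vnorm d (vdiff x y) + vnorm d (vdiff y z)"
proof -
  have "vdiff x z = (\<lambda>i. vdiff x y i + vdiff y z i)" by (simp add: vdiff_def)
  then show ?thesis by (simp add: vnorm_eq_L2_set L2_set_triangle_ineq)
qed

lemma rspace_lcomb: "x \<in> rspace d \<Longrightarrow> y \<in> rspace d \<Longrightarrow> lcomb a x b y \<in> rspace d"
  by (simp add: rspace_def lcomb_def)

lemma rspace_vdiff: "x \<in> rspace d \<Longrightarrow> y \<in> rspace d \<Longrightarrow> vdiff x y \<in> rspace d"
  by (simp add: vdiff_eq_lcomb rspace_lcomb)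

lemma inn_self_eq_0_rspace:
  assumes "x \<in> rspace d" "inn d x x = 0" shows "x = (\<lambda>i. 0)"
proof (rule ext)
  fix i show "x i = 0"
  proof (cases "i < d")
    case True
    with component_sq_le_inn[of i d x] assms(2) show ?thesis by simp
  qed (use assms(1) in \<open>simp add: rspace_def\<close>)
qed

section \<open>The bilinear form of the ONS matrix; its diagonal is \<open>qform\<close>\<close>

definition bil :: "nat \<Rightarrow> real \<Rightarrow> vect list \<Rightarrow> vect \<Rightarrow> vect \<Rightarrow> real" where
  "bil d \<epsilon> gs x y = \<epsilon> * inn d x y + (\<Sum>g\<leftarrow>gs. inn d g x * inn d g y)"

lemma bil_commute: "bil d \<epsilon> gs x y = bil d \<epsilon> gs y x"
  by (simp add: bil_def inn_commute[of d x y] mult.commute)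

lemma bil_Nil: "bil d \<epsilon> [] x y = \<epsilon> * inn d x y"
  by (simp add: bil_def)

lemma bil_append: "bil d \<epsilon> (gs @ [g]) x y = bil d \<epsilon> gs x y + inn d g x * inn d g y"
  by (simp add: bil_def)

lemma bil_Cons: "bil d \<epsilon> (g # gs) x y = bil d \<epsilon> gs x y + inn d g x * inn d g y"
  by (simp add: bil_def)

lemma bil_lcomb_left: "bil d \<epsilon> gs (lcomb a x b y) z = a * bil d \<epsilon> gs x z + b * bil d \<epsilon> gs y z"
  by (induction gs) (simp_all add: bil_Nil bil_Cons inn_lcomb_left inn_lcomb_right algebra_simps)

lemma bil_lcomb_right: "bil d \<epsilon> gs z (lcomb a x b y) = a * bil d \<epsilon> gs z x + b * bil d \<epsilon> gs z y"
  by (metis bil_commute bil_lcomb_left)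

lemma bil_sum_left:
  "bil d \<epsilon> gs (\<lambda>i. \<Sum>k\<in>K. c k * v k i) y = (\<Sum>k\<in>K. c k * bil d \<epsilon> gs (v k) y)"
proof (induction gs)
  case Nil
  then show ?case by (simp add: bil_Nil inn_sum_left sum_distrib_left mult.left_commute)
next
  case (Cons g gs)
  have "inn d g (\<lambda>i. \<Sum>k\<in>K. c k * v k i) = (\<Sum>k\<in>K. c k * inn d g (v k))"
    unfolding inn_commute[of d g] by (rule inn_sum_left)
  with Cons show ?case
    by (simp add: bil_Cons sum.distrib sum_distrib_left sum_distrib_right algebra_simps)
qed

lemma bil_self_ge: "\<epsilon> * inn d x x \<le> bil d \<epsilon> gs x x"
  by (induction gs) (auto simp: bil_Nil bil_Cons intro: add_increasing2)

lemma Amap_Cons: "Amap d \<epsilon> (g # gs) v = lcomb 1 (Amap d \<epsilon> gs v) (inn d g v) g"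
  by (simp add: Amap_def lcomb_def algebra_simps)

lemma inn_Amap: "inn d x (Amap d \<epsilon> gs y) = bil d \<epsilon> gs x y"
proof (induction gs)
  case Nil
  then show ?case by (simp add: Amap_def bil_Nil inn_def sum_distrib_left mult.left_commute)
next
  case (Cons g gs)
  then show ?case
    by (simp add: Amap_Cons inn_lcomb_right bil_Cons inn_commute[of d x g])
qed

lemma qform_eq_bil: "qform d \<epsilon> gs x = bil d \<epsilon> gs x x"
  by (simp add: qform_def inn_Amap)

subsection \<open>The elliptical potential\<close>

text \<open>For \<open>n = m\<close> the \<open>v k\<close> are the columns of the inverse transpose
  of the unit lower triangular factor in the LDL^T decomposition of the matrix of the form, and the
  values \<open>bil m \<epsilon> gs (v k) (v k)\<close> are its pivots, whose product is the
  determinant. A smaller \<open>n\<close> keeps only the first columns.\<close>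

definition conj_system :: "nat \<Rightarrow> real \<Rightarrow> vect list \<Rightarrow> nat \<Rightarrow> (nat \<Rightarrow> vect) \<Rightarrow> bool" where
  "conj_system m \<epsilon> gs n v \<longleftrightarrow>
     (\<forall>k<n. v k k = 1 \<and> (\<forall>i>k. v k i = 0)) \<and>
     (\<forall>k<n. \<forall>l<n. k \<noteq> l \<longrightarrow> bil m \<epsilon> gs (v k) (v l) = 0)"

text \<open>The entry 1 at position \<open>k\<close> forces squared norm at least 1. This makes
  every later division by a pivot and every logarithm of one legitimate.\<close>

lemma conj_system_self_ge:
  assumes "conj_system m \<epsilon> gs n v" "k < n" "n \<le> m" "\<epsilon> > 0"
  shows "bil m \<epsilon> gs (v k) (v k) \<ge> \<epsilon>"
proof -
  have "v k k = 1" using assms by (simp add: conj_system_def)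
  then have "1 \<le> inn m (v k) (v k)" using component_sq_le_inn[of k m "v k"] assms by simp
  then have "\<epsilon> \<le> \<epsilon> * inn m (v k) (v k)" using assms by simp
  then show ?thesis using bil_self_ge[of \<epsilon> m "v k" gs] by linarith
qed

text \<open>Gram-Schmidt for the form, applied to the unit vectors without normalizing: the
  subtracted combination of earlier vectors vanishes from position \<open>n\<close> on, so
  \<open>w\<close> keeps its entry 1 there.\<close>

lemma conj_system_exists:
  assumes "\<epsilon> > 0"
  shows "n \<le> m \<Longrightarrow> \<exists>v. conj_system m \<epsilon> gs n v"
proof (induction n)
  case 0
  then show ?case by (simp add: conj_system_def)
next
  case (Suc n)
  then obtain v where v: "conj_system m \<epsilon> gs n v" by auto
  let ?B = "bil m \<epsilon> gs"
  define c where "c l = ?B (unit_vec n) (v l) / ?B (v l) (v l)" for l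
  define w where "w = lcomb 1 (unit_vec n) (-1) (\<lambda>i. \<Sum>l<n. c l * v l i)"
  have orth: "?B w (v k) = 0" if "k < n" for k
  proof -
    have pos: "?B (v k) (v k) > 0"
      using conj_system_self_ge[OF v that] Suc.prems assms by linarith
    have "(\<Sum>l<n. c l * ?B (v l) (v k)) = (\<Sum>l<n. if l = k then c k * ?B (v k) (v k) else 0)"
      using v that by (intro sum.cong) (auto simp: conj_system_def)
    also have "\<dots> = ?B (unit_vec n) (v k)" using that pos by (simp add: c_def)
    finally show ?thesis by (simp add: w_def bil_lcomb_left bil_sum_left)
  qed
  have "w n = 1" "\<forall>i>n. w i = 0"
    using v by (auto simp: w_def lcomb_def unit_vec_def conj_system_def intro!: sum.neutral)
  then have "conj_system m \<epsilon> gs (Suc n) (v(n := w))"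
    using v orth by (auto simp: conj_system_def less_Suc_eq bil_commute[of m \<epsilon> gs _ w])
  then show ?case by blast
qed

lemma conj_system_expand:
  "conj_system m \<epsilon> gs n v \<Longrightarrow> \<forall>i\<ge>n. x i = 0 \<Longrightarrow> \<exists>c. x = (\<lambda>i. \<Sum>k<n. c k * v k i)"
proof (induction n arbitrary: x)
  case 0
  then show ?case by auto
next
  case (Suc n)
  have v: "conj_system m \<epsilon> gs n v" using Suc.prems by (auto simp: conj_system_def)
  have "lcomb 1 x (- x n) (v n) i = 0" if "i \<ge> n" for i
    using Suc.prems that by (cases "i = n") (auto simp: conj_system_def lcomb_def)
  then have "\<forall>i\<ge>n. lcomb 1 x (- x n) (v n) i = 0" by blast
  from Suc.IH[OF v this] obtain c where c: "lcomb 1 x (- x n) (v n) = (\<lambda>i. \<Sum>k<n. c k * v k i)"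
    by blast
  have "x i = (\<Sum>k<Suc n. (c(n := x n)) k * v k i)" for i
    using fun_cong[OF c, of i] by (simp add: lcomb_def)
  then show ?case by blast
qed

lemma conj_system_bil_expand:
  assumes "conj_system m \<epsilon> gs n v" "x = (\<lambda>i. \<Sum>k<n. c k * v k i)"
  shows "bil m \<epsilon> gs x x = (\<Sum>k<n. (c k)\<^sup>2 * bil m \<epsilon> gs (v k) (v k))"
proof -
  have *: "bil m \<epsilon> gs (v l) x = c l * bil m \<epsilon> gs (v l) (v l)" if "l < n" for l
  proof -
    have "bil m \<epsilon> gs x (v l) = (\<Sum>k<n. c k * bil m \<epsilon> gs (v k) (v l))"
      using assms by (simp add: bil_sum_left)
    also have "\<dots> = (\<Sum>k<n. if k = l then c l * bil m \<epsilon> gs (v l) (v l) else 0)"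
      using assms(1) that by (intro sum.cong) (auto simp: conj_system_def)
    finally show ?thesis using that by (simp add: bil_commute[of m \<epsilon> gs "v l" x])
  qed
  have "bil m \<epsilon> gs x x = (\<Sum>k<n. c k * bil m \<epsilon> gs (v k) x)"
    by (subst (1) assms(2)) (simp add: bil_sum_left)
  also have "\<dots> = (\<Sum>k<n. (c k)\<^sup>2 * bil m \<epsilon> gs (v k) (v k))"
    using * by (intro sum.cong) (auto simp: power2_eq_square)
  finally show ?thesis .
qed

lemma conj_system_mono:
  assumes "conj_system m \<epsilon> gs n v" "n' \<le> n"
  shows "conj_system m \<epsilon> gs n' v"
  using assms by (auto simp: conj_system_def)

text \<open>\<open>x\<close> and \<open>v k\<close> agree from position \<open>k\<close> on, so
  their difference is a combination of earlier vectors and is conjugate to \<open>v k\<close>. The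
  form at \<open>x\<close> is then the form at \<open>v k\<close> plus the nonnegative form at the
  difference.\<close>

lemma conj_system_minimal:
  assumes v: "conj_system m \<epsilon> gs n v" and "k < n" "n \<le> m" "\<epsilon> > 0"
    and x: "x k = 1" "\<forall>i>k. x i = 0"
  shows "bil m \<epsilon> gs (v k) (v k) \<le> bil m \<epsilon> gs x x"
proof -
  let ?B = "bil m \<epsilon> gs"
  let ?r = "lcomb 1 x (-1) (v k)"
  have "\<forall>i\<ge>k. ?r i = 0"
    using v x \<open>k < n\<close> by (auto simp: conj_system_def lcomb_def le_eq_less_or_eq)
  then obtain c where c: "?r = (\<lambda>i. \<Sum>l<k. c l * v l i)"
    using conj_system_expand[OF conj_system_mono[OF v]] \<open>k < n\<close> by (metis less_imp_le)
  have 0: "?B ?r (v k) = 0"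
    unfolding c bil_sum_left using v \<open>k < n\<close>
    by (intro sum.neutral) (auto simp: conj_system_def)
  have "0 \<le> ?B ?r ?r"
    by (rule order_trans[OF _ bil_self_ge]) (simp add: \<open>\<epsilon> > 0\<close> less_imp_le inn_self_nonneg)
  then show ?thesis
    using 0 by (simp add: bil_lcomb_left bil_lcomb_right bil_commute[of _ _ _ x "v k"])
qed

text \<open>Weighted Young inequality in each coordinate of the conjugate system, followed by
  \<open>a / s \<le> - ln (1 - a / s)\<close> and the minimality of the pivots of the smaller form.\<close>

lemma elliptical_step:
  assumes "\<epsilon> > 0" "\<forall>i\<ge>m. x i = 0"
    and v: "conj_system m \<epsilon> gs m v" and v': "conj_system m \<epsilon> (gs @ [h]) m v'"
  shows "2 * inn m h x - bil m \<epsilon> (gs @ [h]) x x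
    \<le> (\<Sum>k<m. ln (bil m \<epsilon> (gs @ [h]) (v' k) (v' k) / \<epsilon>)) - (\<Sum>k<m. ln (bil m \<epsilon> gs (v k) (v k) / \<epsilon>))"
proof -
  let ?B = "bil m \<epsilon> gs" and ?B' = "bil m \<epsilon> (gs @ [h])"
  obtain c where c: "x = (\<lambda>i. \<Sum>k<m. c k * v' k i)"
    using conj_system_expand[OF v' assms(2)] by blast
  have hx: "inn m h x = (\<Sum>k<m. c k * inn m h (v' k))"
    unfolding c inn_commute[of m h] by (rule inn_sum_left)
  have term_le: "2 * (c k * inn m h (v' k)) - (c k)\<^sup>2 * ?B' (v' k) (v' k)
      \<le> ln (?B' (v' k) (v' k) / \<epsilon>) - ln (?B (v k) (v k) / \<epsilon>)" if k: "k < m" for k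
  proof -
    define s s' a where "s = ?B (v k) (v k)" and "s' = ?B' (v' k) (v' k)" and "a = inn m h (v' k)"
    have "s > 0" "s' > 0"
      using conj_system_self_ge[OF v k] conj_system_self_ge[OF v' k] assms by (auto simp: s_def s'_def)
    have "s \<le> ?B (v' k) (v' k)"
      unfolding s_def using v' k assms(1)
      by (intro conj_system_minimal[OF v k]) (auto simp: conj_system_def)
    then have le: "s \<le> s' - a\<^sup>2"
      by (simp add: s'_def a_def bil_append power2_eq_square)
    have "0 \<le> (c k * s' - a)\<^sup>2 / s'" using \<open>s' > 0\<close> by simp
    then have "2 * (c k * a) - (c k)\<^sup>2 * s' \<le> a\<^sup>2 / s'"
      using \<open>s' > 0\<close> by (simp add: field_simps power2_eq_square)
    also have "\<dots> \<le> 1 - s / s'" using le \<open>s' > 0\<close> by (simp add: field_simps)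
    also have "\<dots> \<le> - ln (s / s')" using ln_le_minus_one[of "s / s'"] \<open>s > 0\<close> \<open>s' > 0\<close> by simp
    also have "\<dots> = ln (s' / \<epsilon>) - ln (s / \<epsilon>)"
      using \<open>s > 0\<close> \<open>s' > 0\<close> assms by (simp add: ln_div)
    finally show ?thesis by (simp add: s_def s'_def a_def)
  qed
  have "2 * inn m h x - ?B' x x
      = (\<Sum>k<m. 2 * (c k * inn m h (v' k)) - (c k)\<^sup>2 * ?B' (v' k) (v' k))"
    unfolding hx conj_system_bil_expand[OF v' c] by (simp add: sum_subtractf sum_distrib_left)
  also have "\<dots> \<le> (\<Sum>k<m. ln (?B' (v' k) (v' k) / \<epsilon>) - ln (?B (v k) (v k) / \<epsilon>))"
    by (rule sum_mono) (use term_le in auto)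
  finally show ?thesis by (simp add: sum_subtractf)
qed

text \<open>The single steps telescope, and the initial potential is nonnegative because every pivot
  is at least \<open>\<epsilon>\<close>. The bound holds for all \<open>v\<close>, so the induction
  hypothesis may be applied to a system chosen for the shorter list.\<close>

lemma elliptical_potential_pivots:
  assumes "\<epsilon> > 0" "\<And>t i. i \<ge> m \<Longrightarrow> c t i = 0"
  shows "conj_system m \<epsilon> (map h [j..<j+n]) m v \<Longrightarrow>
    (\<Sum>t=j..<j+n. 2 * inn m (h t) (c t) - bil m \<epsilon> (map h [j..<Suc t]) (c t) (c t))
      \<le> (\<Sum>k<m. ln (bil m \<epsilon> (map h [j..<j+n]) (v k) (v k) / \<epsilon>))"
proof (induction n arbitrary: v)
  case 0
  have "0 \<le> ln (bil m \<epsilon> [] (v k) (v k) / \<epsilon>)" if "k < m" for k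
    using conj_system_self_ge[of m \<epsilon> "[]" m v k] 0 assms(1) that by simp
  then have "0 \<le> (\<Sum>k<m. ln (bil m \<epsilon> [] (v k) (v k) / \<epsilon>))" by (intro sum_nonneg) auto
  then show ?case by simp
next
  case (Suc n)
  obtain v0 where v0: "conj_system m \<epsilon> (map h [j..<j+n]) m v0"
    using conj_system_exists[OF assms(1)] by blast
  have eq: "map h [j..<j + Suc n] = map h [j..<j+n] @ [h (j+n)]" by simp
  show ?case
    using Suc.IH[OF v0] elliptical_step[of \<epsilon> m "c (j+n)" "map h [j..<j+n]" v0 "h (j+n)" v]
      v0 Suc.prems assms unfolding eq by simp
qed

text \<open>Each pivot is at most the corresponding diagonal entry of the form, since the unit
  vector competes in the minimization. The bound on the entries of the \<open>h t\<close> makes this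
  diagonal entry at most \<open>\<epsilon> + n * G^2\<close>.\<close>

lemma elliptical_potential:
  assumes "\<epsilon> > 0" "\<And>t i. i \<ge> m \<Longrightarrow> c t i = 0"
    and G: "\<And>t k. t \<in> {j..<j+n} \<Longrightarrow> k < m \<Longrightarrow> \<bar>h t k\<bar> \<le> G"
  shows "(\<Sum>t=j..<j+n. 2 * inn m (h t) (c t) - bil m \<epsilon> (map h [j..<Suc t]) (c t) (c t))
      \<le> real m * ln (1 + real n * G\<^sup>2 / \<epsilon>)"
proof -
  obtain v where v: "conj_system m \<epsilon> (map h [j..<j+n]) m v"
    using conj_system_exists[OF assms(1)] by blast
  let ?B = "bil m \<epsilon> (map h [j..<j+n])"
  have "ln (?B (v k) (v k) / \<epsilon>) \<le> ln (1 + real n * G\<^sup>2 / \<epsilon>)" if k: "k < m" for k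
  proof -
    have "?B (v k) (v k) \<le> ?B (unit_vec k) (unit_vec k)"
      using assms(1) k by (intro conj_system_minimal[OF v k]) (auto simp: unit_vec_def)
    also have "\<dots> = \<epsilon> + (\<Sum>t=j..<j+n. (h t k)\<^sup>2)"
      using k by (simp add: bil_def inn_unit_vec o_def interv_sum_list_conv_sum_set_nat
          power2_eq_square) (simp add: unit_vec_def)
    also have "\<dots> \<le> \<epsilon> + (\<Sum>t=j..<j+n. G\<^sup>2)"
      using G k by (intro add_left_mono sum_mono) (metis abs_le_square_iff abs_ge_self order_trans)
    finally have "?B (v k) (v k) / \<epsilon> \<le> 1 + real n * G\<^sup>2 / \<epsilon>"
      using assms(1) by (simp add: field_simps)
    moreover have "?B (v k) (v k) > 0" using conj_system_self_ge[OF v k] assms(1) by simp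
    ultimately show ?thesis using assms(1) by (subst ln_le_cancel_iff) (auto intro: add_pos_nonneg)
  qed
  then have "(\<Sum>k<m. ln (?B (v k) (v k) / \<epsilon>)) \<le> (\<Sum>k<m. ln (1 + real n * G\<^sup>2 / \<epsilon>))"
    by (intro sum_mono) auto
  also have "\<dots> = real m * ln (1 + real n * G\<^sup>2 / \<epsilon>)" by simp
  finally have "(\<Sum>k<m. ln (?B (v k) (v k) / \<epsilon>)) \<le> real m * ln (1 + real n * G\<^sup>2 / \<epsilon>)" .
  moreover have "(\<Sum>t=j..<j+n. 2 * inn m (h t) (c t) - bil m \<epsilon> (map h [j..<Suc t]) (c t) (c t))
      \<le> (\<Sum>k<m. ln (?B (v k) (v k) / \<epsilon>))"
    by (rule elliptical_potential_pivots) (use assms v in auto)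
  ultimately show ?thesis by linarith
qed

subsection \<open>Orthonormal bases of subspaces\<close>

definition lin_subspace :: "nat \<Rightarrow> vect set \<Rightarrow> bool" where
  "lin_subspace d W \<longleftrightarrow> W \<subseteq> rspace d \<and> W \<noteq> {} \<and>
     (\<forall>x\<in>W. \<forall>y\<in>W. \<forall>a b. lcomb a x b y \<in> W)"

definition orthonormal :: "nat \<Rightarrow> nat \<Rightarrow> (nat \<Rightarrow> vect) \<Rightarrow> bool" where
  "orthonormal d m b \<longleftrightarrow> (\<forall>k<m. \<forall>l<m. inn d (b k) (b l) = (if k = l then 1 else 0))"

definition coords :: "nat \<Rightarrow> nat \<Rightarrow> (nat \<Rightarrow> vect) \<Rightarrow> vect \<Rightarrow> vect" where
  "coords d m b w = (\<lambda>k. if k < m then inn d w (b k) else 0)"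

definition from_coords :: "nat \<Rightarrow> (nat \<Rightarrow> vect) \<Rightarrow> vect \<Rightarrow> vect" where
  "from_coords m b c = (\<lambda>i. \<Sum>k<m. c k * b k i)"

lemma inn_from_coords: "inn d (from_coords m b c) y = (\<Sum>k<m. c k * inn d (b k) y)"
  by (simp add: from_coords_def inn_sum_left)

lemma inn_from_coords_basis:
  assumes "orthonormal d m b" "l < m"
  shows "inn d (from_coords m b c) (b l) = c l"
proof -
  have "inn d (from_coords m b c) (b l) = (\<Sum>k<m. if k = l then c l else 0)"
    unfolding inn_from_coords using assms by (intro sum.cong) (auto simp: orthonormal_def)
  then show ?thesis using assms by simp
qed

text \<open>\<open>r x\<close> is \<open>x\<close> minus its orthogonal projection; the second part
  is Pythagoras and yields Bessel's inequality.\<close>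

lemma orthonormal_residual:
  assumes "orthonormal d m b"
  defines "r \<equiv> \<lambda>x. lcomb 1 x (-1) (from_coords m b (coords d m b x))"
  shows "l < m \<Longrightarrow> inn d (r x) (b l) = 0"
    and "inn d (r x) (r x) = inn d x x - (\<Sum>k<m. (inn d x (b k))\<^sup>2)"
proof -
  have 0: "inn d (r x) (b l) = 0" if "l < m" for l
    using that by (simp add: r_def inn_lcomb_left inn_from_coords_basis[OF assms(1)] coords_def)
  then show "l < m \<Longrightarrow> inn d (r x) (b l) = 0" .
  have "inn d (r x) (r x) = inn d x (r x) - inn d (from_coords m b (coords d m b x)) (r x)"
    by (subst (1) r_def) (simp add: inn_lcomb_left)
  also have "inn d (from_coords m b (coords d m b x)) (r x) = 0"
    unfolding inn_from_coords using 0 by (simp add: inn_commute[of d "b _"])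
  also have "inn d x (r x) = inn d x x - (\<Sum>k<m. (inn d x (b k))\<^sup>2)"
    by (simp add: r_def inn_lcomb_right inn_commute[of d x "from_coords _ _ _"] inn_from_coords
        coords_def power2_eq_square inn_commute[of d "b _" x])
  finally show "inn d (r x) (r x) = inn d x x - (\<Sum>k<m. (inn d x (b k))\<^sup>2)" by simp
qed

lemma bessel: "orthonormal d m b \<Longrightarrow> (\<Sum>k<m. (inn d x (b k))\<^sup>2) \<le> inn d x x"
  using orthonormal_residual(2)[of d m b x]
    inn_self_nonneg[of d "lcomb 1 x (-1) (from_coords m b (coords d m b x))"] by linarith

text \<open>Double counting of the squared entries of the \<open>b k\<close>: summed by vector they
  give \<open>m\<close>, and summed by coordinate Bessel's inequality gives at most 1 for each of
  the \<open>d\<close> coordinates.\<close>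

lemma orthonormal_card_le:
  assumes "orthonormal d m b"
  shows "m \<le> d"
proof -
  have "real m = (\<Sum>k<m. inn d (b k) (b k))" using assms by (simp add: orthonormal_def)
  also have "\<dots> = (\<Sum>k<m. \<Sum>i<d. (inn d (unit_vec i) (b k))\<^sup>2)"
    by (simp add: inn_commute[of d "unit_vec _"] inn_unit_vec) (simp add: inn_def power2_eq_square)
  also have "\<dots> = (\<Sum>i<d. \<Sum>k<m. (inn d (unit_vec i) (b k))\<^sup>2)" by (rule sum.swap)
  also have "\<dots> \<le> (\<Sum>i<d. 1)"
  proof (rule sum_mono)
    fix i assume "i \<in> {..<d}"
    then have "inn d (unit_vec i) (unit_vec i) = 1" by (simp add: inn_unit_vec) (simp add: unit_vec_def)
    then show "(\<Sum>k<m. (inn d (unit_vec i) (b k))\<^sup>2) \<le> 1" using bessel[OF assms] by metis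
  qed
  finally show ?thesis by simp
qed

lemma lin_subspace_from_coords:
  assumes "lin_subspace d W" "\<forall>k<m. b k \<in> W"
  shows "from_coords m b c \<in> W"
  using assms(2)
proof (induction m)
  case 0
  obtain w where "w \<in> W" using assms(1) by (auto simp: lin_subspace_def)
  then have "lcomb 0 w 0 w \<in> W" using assms(1) by (auto simp: lin_subspace_def)
  then show ?case by (simp add: from_coords_def lcomb_def)
next
  case (Suc m)
  have "from_coords (Suc m) b c = lcomb 1 (from_coords m b c) (c m) (b m)"
    by (simp add: from_coords_def lcomb_def)
  then show ?case using Suc assms(1) by (simp add: lin_subspace_def)
qed

text \<open>An orthonormal system in \<open>W\<close> of the largest possible size spans
  \<open>W\<close>, since a nonzero residual, once normalized, would extend it. The size is bounded
  by \<open>d\<close>, so a largest one exists.\<close>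

lemma orthonormal_basis_exists:
  assumes W: "lin_subspace d W"
  obtains m b where "m \<le> d" "orthonormal d m b" "\<forall>k<m. b k \<in> W"
    "\<And>w. w \<in> W \<Longrightarrow> from_coords m b (coords d m b w) = w"
proof -
  define P where "P m \<longleftrightarrow> (\<exists>b. orthonormal d m b \<and> (\<forall>k<m. b k \<in> W))" for m
  define m where "m = Greatest P"
  have "P 0" by (simp add: P_def orthonormal_def)
  moreover have bnd: "\<forall>n. P n \<longrightarrow> n \<le> d" using orthonormal_card_le by (auto simp: P_def)
  ultimately have "P m" unfolding m_def by (metis GreatestI_nat)
  then obtain b where b: "orthonormal d m b" "\<forall>k<m. b k \<in> W" by (auto simp: P_def)
  have "from_coords m b (coords d m b w) = w" if w: "w \<in> W" for w
  proof (rule ccontr)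
    assume neq: "from_coords m b (coords d m b w) \<noteq> w"
    define r where "r = lcomb 1 w (-1) (from_coords m b (coords d m b w))"
    have rW: "r \<in> W"
      using W w lin_subspace_from_coords[OF W b(2)] by (simp add: lin_subspace_def r_def)
    have orth: "inn d r (b l) = 0" if "l < m" for l
      using orthonormal_residual(1)[OF b(1) that] by (simp add: r_def)
    have "inn d r r \<noteq> 0"
    proof
      assume "inn d r r = 0"
      then have "r = (\<lambda>i. 0)" using inn_self_eq_0_rspace rW W by (auto simp: lin_subspace_def)
      then have "w i = from_coords m b (coords d m b w) i" for i
        by (simp add: r_def lcomb_def fun_eq_iff)
      then show False using neq by auto
    qed
    then have pos: "inn d r r > 0" using inn_self_nonneg[of d r] by linarith
    define u where "u = vscale (1 / sqrt (inn d r r)) r"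
    have uW: "u \<in> W" using W rW by (simp add: lin_subspace_def u_def vscale_eq_lcomb)
    have "inn d u u = 1"
      using pos by (simp add: u_def vscale_eq_lcomb inn_lcomb_left inn_lcomb_right flip: real_sqrt_mult)
    moreover have u_orth: "inn d u (b l) = 0" if "l < m" for l
      using orth that by (simp add: u_def vscale_eq_lcomb inn_lcomb_left)
    moreover have "inn d (b l) u = 0" if "l < m" for l
      using u_orth[OF that] by (simp only: inn_commute)
    ultimately have "orthonormal d (Suc m) (b(m := u))"
      using b(1) by (auto simp: orthonormal_def less_Suc_eq)
    moreover have "\<forall>k<Suc m. (b(m := u)) k \<in> W" using b(2) uW by (simp add: less_Suc_eq)
    ultimately have "P (Suc m)" unfolding P_def by blast
    then have "Suc m \<le> m" unfolding m_def by (rule Greatest_le_nat) (use bnd in blast)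
    then show False by simp
  qed
  then show thesis using that[of m b] b bnd \<open>P m\<close> by blast
qed

text \<open>Only \<open>w\<close> must lie in the span of the basis; the part of \<open>g\<close>
  orthogonal to that span does not contribute.\<close>

lemma inn_coords:
  assumes "from_coords m b (coords d m b w) = w"
  shows "inn d g w = inn m (coords d m b g) (coords d m b w)"
proof -
  have "inn d g w = inn d (from_coords m b (coords d m b w)) g"
    by (simp add: assms inn_commute)
  also have "\<dots> = (\<Sum>k<m. coords d m b w k * inn d g (b k))"
    by (simp add: inn_from_coords inn_commute[of d g])
  also have "\<dots> = inn m (coords d m b g) (coords d m b w)"
    unfolding inn_def[of m] by (intro sum.cong) (auto simp: coords_def[of d m b g])
  finally show ?thesis .
qed

lemma bil_coords:
  assumes "from_coords m b (coords d m b w) = w"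
  shows "bil d \<epsilon> gs w w = bil m \<epsilon> (map (coords d m b) gs) (coords d m b w) (coords d m b w)"
  by (induction gs) (simp_all add: bil_Nil bil_Cons inn_coords[OF assms, symmetric])

text \<open>Only the action of the vectors \<open>h t\<close> on \<open>W\<close> is bounded: the gradients of the losses have
  uncontrolled components orthogonal to the decision set when that set has empty interior.\<close>

lemma elliptical_potential_subspace:
  assumes "\<epsilon> > 0" and W: "lin_subspace d W"
    and G: "\<And>t w. t \<in> {j..<j+n} \<Longrightarrow> w \<in> W \<Longrightarrow> \<bar>inn d (h t) w\<bar> \<le> G * vnorm d w"
    and c: "\<And>t. t \<in> {j..<j+n} \<Longrightarrow> c t \<in> W"
  shows "(\<Sum>t=j..<j+n. 2 * inn d (h t) (c t) - bil d \<epsilon> (map h [j..<Suc t]) (c t) (c t))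
      \<le> real d * ln (1 + real n * G\<^sup>2 / \<epsilon>)"
proof -
  obtain m b where mb: "m \<le> d" "orthonormal d m b" "\<forall>k<m. b k \<in> W"
    and span: "\<And>w. w \<in> W \<Longrightarrow> from_coords m b (coords d m b w) = w"
    using orthonormal_basis_exists[OF W] by metis
  let ?co = "coords d m b"
  have "(\<Sum>t=j..<j+n. 2 * inn d (h t) (c t) - bil d \<epsilon> (map h [j..<Suc t]) (c t) (c t))
    = (\<Sum>t=j..<j+n. 2 * inn m (?co (h t)) (?co (c t))
        - bil m \<epsilon> (map (\<lambda>t. ?co (h t)) [j..<Suc t]) (?co (c t)) (?co (c t)))"
  proof (rule sum.cong[OF refl])
    fix t assume "t \<in> {j..<j+n}"
    then have s: "from_coords m b (?co (c t)) = c t" using c span by blast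
    show "2 * inn d (h t) (c t) - bil d \<epsilon> (map h [j..<Suc t]) (c t) (c t)
      = 2 * inn m (?co (h t)) (?co (c t))
        - bil m \<epsilon> (map (\<lambda>t. ?co (h t)) [j..<Suc t]) (?co (c t)) (?co (c t))"
      unfolding bil_coords[OF s] inn_coords[OF s, of "h t"] by (simp add: o_def)
  qed
  also have "\<dots> \<le> real m * ln (1 + real n * G\<^sup>2 / \<epsilon>)"
  proof (rule elliptical_potential[OF assms(1)])
    fix t k assume t: "t \<in> {j..<j+n}" and k: "k < m"
    have "vnorm d (b k) = 1" using mb(2) k by (simp add: vnorm_def orthonormal_def)
    then show "\<bar>?co (h t) k\<bar> \<le> G" using G[OF t, of "b k"] mb(3) k by (simp add: coords_def)
  qed (simp add: coords_def)
  also have "\<dots> \<le> real d * ln (1 + real n * G\<^sup>2 / \<epsilon>)"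
    using mb(1) assms(1) by (intro mult_right_mono) auto
  finally show ?thesis .
qed

subsection \<open>The Online Newton Step\<close>

lemma Amap_lcomb: "Amap d \<epsilon> gs (lcomb a x b y) = lcomb a (Amap d \<epsilon> gs x) b (Amap d \<epsilon> gs y)"
proof (induction gs)
  case Nil
  then show ?case by (simp add: Amap_def lcomb_def algebra_simps)
next
  case (Cons g gs)
  show ?case
    unfolding Amap_Cons Cons inn_lcomb_right by (simp add: lcomb_def algebra_simps)
qed

text \<open>Solvability by induction on the rank, via the Sherman-Morrison formula.\<close>

lemma Amap_surj:
  assumes "\<epsilon> > 0"
  shows "set gs \<subseteq> rspace d \<Longrightarrow> w \<in> rspace d \<Longrightarrow> \<exists>v\<in>rspace d. Amap d \<epsilon> gs v = w"
proof (induction gs arbitrary: w)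
  case Nil
  then show ?case using assms
    by (intro bexI[of _ "vscale (1/\<epsilon>) w"]) (auto simp: Amap_def vscale_def rspace_def)
next
  case (Cons g gs)
  then obtain u h where u: "u \<in> rspace d" "Amap d \<epsilon> gs u = w"
    and h: "h \<in> rspace d" "Amap d \<epsilon> gs h = g"
    by (metis insert_subset list.simps(15))
  \<comment> \<open>With \<open>h\<close> the preimage of \<open>g\<close>, this number is the value
    of the form at \<open>h\<close>, so the Sherman-Morrison denominator is at least 1.\<close>
  have "inn d g h = bil d \<epsilon> gs h h" using h by (metis inn_Amap inn_commute)
  then have pos: "inn d g h \<ge> 0"
    using order_trans[OF _ bil_self_ge[of \<epsilon> d h gs]] inn_self_nonneg[of d h] assms by simp
  define c where "c = inn d g u / (1 + inn d g h)"
  have "c * (1 + inn d g h) = inn d g u" using pos by (simp add: c_def)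
  then have c: "inn d g u - c * inn d g h = c" by (simp add: algebra_simps)
  have "Amap d \<epsilon> (g # gs) (lcomb 1 u (- c) h) = lcomb 1 (lcomb 1 w (- c) g) (inn d g u - c * inn d g h) g"
    by (simp add: Amap_Cons Amap_lcomb u h inn_lcomb_right) (simp add: lcomb_def algebra_simps)
  also have "\<dots> = w" unfolding c by (simp add: lcomb_def)
  finally show ?case using rspace_lcomb u h by blast
qed

lemma Amap_inj:
  assumes "\<epsilon> > 0" "x \<in> rspace d" "y \<in> rspace d" "Amap d \<epsilon> gs x = Amap d \<epsilon> gs y"
  shows "x = y"
proof -
  let ?z = "lcomb 1 x (-1) y"
  have "bil d \<epsilon> gs ?z ?z = 0"
    by (simp flip: inn_Amap add: Amap_lcomb assms(4) inn_lcomb_right)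
  then have "inn d ?z ?z = 0"
    using bil_self_ge[of \<epsilon> d ?z gs] inn_self_nonneg[of d ?z] assms(1)
    by (metis mult_less_cancel_left_pos mult_zero_right order_less_le not_less)
  then have "?z = (\<lambda>i. 0)" by (intro inn_self_eq_0_rspace) (use assms rspace_lcomb in auto)
  then show ?thesis by (auto simp: lcomb_def fun_eq_iff)
qed

text \<open>The type \<open>vect\<close> carries the product topology. A bounded set in
  \<open>rspace d\<close> lies in a product of compact intervals, degenerate from coordinate
  \<open>d\<close> on, and this product is compact by Tychonoff's theorem.\<close>

lemma compact_decision_set:
  assumes "closed D" "D \<subseteq> rspace d" "\<forall>x\<in>D. \<forall>y\<in>D. vnorm d (vdiff x y) \<le> R"
  shows "compact D"
proof (cases "D = {}")
  case False
  then obtain a where a: "a \<in> D" by blast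
  define K where "K i = (if i < d then {a i - R..a i + R} else {0})" for i
  have "D \<subseteq> PiE UNIV K"
  proof
    fix x assume x: "x \<in> D"
    have "x i \<in> K i" for i
    proof (cases "i < d")
      case True
      have "(vdiff x a i)\<^sup>2 \<le> (vnorm d (vdiff x a))\<^sup>2"
        unfolding vnorm_sq using True by (rule component_sq_le_inn)
      also have "\<dots> \<le> R\<^sup>2" using assms(3) x a by (intro power_mono) (auto simp: vnorm_nonneg)
      finally have "\<bar>vdiff x a i\<bar> \<le> \<bar>R\<bar>" by (simp add: abs_le_square_iff)
      moreover have "R \<ge> 0" using assms(3) x a vnorm_nonneg order_trans by blast
      ultimately show ?thesis using True by (auto simp: K_def vdiff_def)
    next
      case False
      then show ?thesis using x assms(2) by (auto simp: K_def rspace_def)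
    qed
    then show "x \<in> PiE UNIV K" by auto
  qed
  moreover have "compact (PiE UNIV K)"
    using compactin_PiE[of "\<lambda>_. euclidean" UNIV K]
    by (auto simp: euclidean_product_topology K_def)
  ultimately have "compact (PiE UNIV K \<inter> D)" "PiE UNIV K \<inter> D = D"
    using assms(1) by (auto intro: compact_Int_closed)
  then show ?thesis by simp
qed auto

lemma continuous_on_inn:
  assumes "continuous_on S f" "continuous_on S g"
  shows "continuous_on S (\<lambda>x. inn d (f x) (g x))"
  unfolding inn_def
  by (intro continuous_on_sum continuous_on_mult continuous_on_product_then_coordinatewise[OF assms(1)]
      continuous_on_product_then_coordinatewise[OF assms(2)])

lemma continuous_on_bil_vdiff:
  "continuous_on S (\<lambda>x. bil d \<epsilon> gs (vdiff y x) (vdiff y x))"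
proof -
  have "continuous_on S (\<lambda>x. y i - x i)" for i :: nat
    by (intro continuous_on_diff continuous_on_const
        continuous_on_subset[OF continuous_on_product_coordinates]) auto
  then have v: "continuous_on S (vdiff y)"
    unfolding vdiff_def by (rule continuous_on_coordinatewise_then_product)
  show ?thesis
    by (induction gs) (auto simp: bil_Nil bil_Cons intro!: continuous_on_add continuous_on_mult
        continuous_on_inn v continuous_on_const)
qed

text \<open>Resolves the two choice operators of \<open>ons_step\<close>: invertibility of the
  matrix gives the unique \<open>y\<close>, compactness gives a projection. The first-order
  condition of the projection is then stated without \<open>y\<close>.\<close>

lemma ons_step_variational:
  fixes \<gamma> :: real
  assumes "\<epsilon> > 0" "closed D" "D \<subseteq> rspace d" "\<forall>x\<in>D. \<forall>y\<in>D. vnorm d (vdiff x y) \<le> R"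
    and cvx: "convex_set D"
    and gs: "set gs \<subseteq> rspace d" "g \<in> rspace d" and p: "p \<in> D"
  defines "x \<equiv> ons_step d D \<gamma> \<epsilon> gs g p"
  shows "x \<in> D"
    and "u \<in> D \<Longrightarrow> 0 \<le> bil d \<epsilon> gs (vdiff x p) (vdiff u x) + inn d g (vdiff u x) / \<gamma>"
proof -
  define y where "y = (THE y. y \<in> rspace d \<and> Amap d \<epsilon> gs (vdiff p y) = vscale (1/\<gamma>) g)"
  have p': "p \<in> rspace d" using p assms(3) by blast
  have "vscale (1/\<gamma>) g \<in> rspace d" using gs by (simp add: vscale_eq_lcomb rspace_lcomb)
  then obtain v where v: "v \<in> rspace d" "Amap d \<epsilon> gs v = vscale (1/\<gamma>) g"
    using Amap_surj[OF assms(1) gs(1)] by blast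
  have "\<exists>!y. y \<in> rspace d \<and> Amap d \<epsilon> gs (vdiff p y) = vscale (1/\<gamma>) g"
  proof (rule ex_ex1I)
    have "vdiff p (vdiff p v) = v" by (simp add: vdiff_def)
    then show "\<exists>y. y \<in> rspace d \<and> Amap d \<epsilon> gs (vdiff p y) = vscale (1/\<gamma>) g"
      using v p' by (intro exI[of _ "vdiff p v"]) (simp add: rspace_vdiff)
  next
    fix y y' assume *: "y \<in> rspace d \<and> Amap d \<epsilon> gs (vdiff p y) = vscale (1/\<gamma>) g"
      "y' \<in> rspace d \<and> Amap d \<epsilon> gs (vdiff p y') = vscale (1/\<gamma>) g"
    then have "Amap d \<epsilon> gs (vdiff p y) = Amap d \<epsilon> gs (vdiff p y')" by simp
    then have "vdiff p y = vdiff p y'"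
      by (rule Amap_inj[OF assms(1), rotated -1]) (use * p' in \<open>auto simp: rspace_vdiff\<close>)
    then show "y = y'" by (simp add: vdiff_def fun_eq_iff)
  qed
  from theI'[OF this] have y: "y \<in> rspace d" "Amap d \<epsilon> gs (vdiff p y) = vscale (1/\<gamma>) g"
    by (auto simp: y_def)
  have "\<exists>x\<in>D. \<forall>x'\<in>D. qform d \<epsilon> gs (vdiff y x) \<le> qform d \<epsilon> gs (vdiff y x')"
    unfolding qform_eq_bil
    by (rule continuous_attains_inf[OF compact_decision_set[OF assms(2-4)] _ continuous_on_bil_vdiff])
       (use p in auto)
  then have "\<exists>x. x \<in> D \<and> (\<forall>x'\<in>D. qform d \<epsilon> gs (vdiff y x) \<le> qform d \<epsilon> gs (vdiff y x'))" by blast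
  from someI_ex[OF this] have x: "x \<in> D"
    and min: "\<And>x'. x' \<in> D \<Longrightarrow> qform d \<epsilon> gs (vdiff y x) \<le> qform d \<epsilon> gs (vdiff y x')"
    by (auto simp: x_def ons_step_def y_def Let_def)
  show "x \<in> D" by fact
  show "0 \<le> bil d \<epsilon> gs (vdiff x p) (vdiff u x) + inn d g (vdiff u x) / \<gamma>" if u: "u \<in> D"
  proof -
    let ?B = "bil d \<epsilon> gs"
    let ?w = "vdiff u x" and ?z = "vdiff y x"
    \<comment> \<open>Minimality of \<open>x\<close> is compared with the point a fraction
      \<open>l\<close> of the way to \<open>u\<close>; dividing by \<open>l\<close> and letting
      \<open>l\<close> tend to 0 leaves the first-order condition.\<close>
    have "2 * ?B ?z ?w \<le> l * ?B ?w ?w" if l: "0 < l" "l \<le> 1" for l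
    proof -
      have "(\<lambda>i. l * u i + (1 - l) * x i) \<in> D"
        using cvx u x l unfolding convex_set_def by (meson less_imp_le)
      moreover have "vdiff y (\<lambda>i. l * u i + (1 - l) * x i) = lcomb 1 ?z (- l) ?w"
        by (simp add: vdiff_def lcomb_def algebra_simps)
      ultimately have "?B ?z ?z \<le> ?B (lcomb 1 ?z (- l) ?w) (lcomb 1 ?z (- l) ?w)"
        using min by (metis qform_eq_bil)
      then have "l * (2 * ?B ?z ?w) \<le> l * (l * ?B ?w ?w)"
        by (simp add: bil_lcomb_left bil_lcomb_right bil_commute[of d \<epsilon> gs ?w ?z] algebra_simps)
      then show ?thesis using l by simp
    qed
    then have "eventually (\<lambda>l. 2 * ?B ?z ?w \<le> l * ?B ?w ?w) (at_right 0)"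
      by (intro eventually_at_rightI[of 0 1]) auto
    moreover have "((\<lambda>l. l * ?B ?w ?w) \<longlongrightarrow> 0 * ?B ?w ?w) (at_right 0)"
      by (intro tendsto_intros)
    ultimately have "2 * ?B ?z ?w \<le> 0"
      using tendsto_lowerbound[of "\<lambda>l. l * ?B ?w ?w" 0 "at_right 0" "2 * ?B ?z ?w"] by simp
    \<comment> \<open>The defining equation of \<open>y\<close> turns the form at
      \<open>vdiff p y\<close> into the gradient term, which eliminates \<open>y\<close>.\<close>
    moreover have "?B (vdiff p y) ?w = inn d g ?w / \<gamma>"
      using inn_Amap[of d ?w \<epsilon> gs "vdiff p y"] unfolding y(2)
      by (simp add: vscale_eq_lcomb inn_lcomb_right inn_commute[of d g] bil_commute[of d \<epsilon> gs ?w])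
    moreover have "vdiff x p = lcomb (-1) ?z (-1) (vdiff p y)"
      by (simp add: vdiff_def lcomb_def)
    ultimately show ?thesis by (simp add: bil_lcomb_left)
  qed
qed

subsection \<open>Losses along segments\<close>

lemma segment_in_convex_set:
  assumes "convex_set D" "x \<in> D" "y \<in> D" "0 \<le> s" "s \<le> 1"
  shows "lcomb 1 x s (vdiff y x) \<in> D"
proof -
  have "lcomb 1 x s (vdiff y x) = (\<lambda>i. s * y i + (1 - s) * x i)"
    by (simp add: lcomb_def vdiff_def algebra_simps)
  then show ?thesis using assms by (simp add: convex_set_def)
qed

text \<open>\<open>has_grad\<close> controls \<open>f\<close> on all of \<open>rspace d\<close>, so
  the derivative is two-sided even at an end of a segment in the decision set.\<close>

lemma has_grad_line:
  assumes g: "has_grad d f g (lcomb 1 x l w)" and "x \<in> rspace d" "w \<in> rspace d"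
  shows "((\<lambda>s. f (lcomb 1 x s w)) has_field_derivative inn d g w) (at l)"
  unfolding DERIV_def LIM_eq
proof (intro allI impI)
  fix e :: real assume "e > 0"
  let ?N = "vnorm d w"
  have N: "0 < ?N + 1" using vnorm_nonneg[of d w] by simp
  \<comment> \<open>The added 1 admits \<open>w = 0\<close> and makes the last estimate
    strict.\<close>
  then have "e / (?N + 1) > 0" using \<open>e > 0\<close> by simp
  then obtain \<delta> where "\<delta> > 0" and \<delta>: "\<And>y. y \<in> rspace d \<Longrightarrow> vnorm d (vdiff y (lcomb 1 x l w)) < \<delta> \<Longrightarrow>
      \<bar>f y - f (lcomb 1 x l w) - inn d g (vdiff y (lcomb 1 x l w))\<bar>
        \<le> e / (?N + 1) * vnorm d (vdiff y (lcomb 1 x l w))"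
    using g unfolding has_grad_def by blast
  have "norm ((f (lcomb 1 x (l + h) w) - f (lcomb 1 x l w)) / h - inn d g w) < e"
    if h: "h \<noteq> 0" "norm (h - 0) < \<delta> / (?N + 1)" for h
  proof -
    have dv: "vdiff (lcomb 1 x (l + h) w) (lcomb 1 x l w) = vscale h w"
      by (simp add: vdiff_def lcomb_def vscale_def algebra_simps)
    have "\<bar>h\<bar> * (?N + 1) < \<delta>" using h(2) N by (simp add: field_simps)
    then have "\<bar>h\<bar> * ?N < \<delta>" by (simp add: distrib_left)
    then have "\<bar>f (lcomb 1 x (l + h) w) - f (lcomb 1 x l w) - h * inn d g w\<bar> \<le> e / (?N + 1) * (\<bar>h\<bar> * ?N)"
      using \<delta>[of "lcomb 1 x (l + h) w"] assms
      by (simp add: dv rspace_lcomb vnorm_vscale) (simp add: vscale_eq_lcomb inn_lcomb_right)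
    also have "\<dots> = \<bar>h\<bar> * (e * ?N / (?N + 1))" by simp
    also have "\<dots> < \<bar>h\<bar> * e"
      using h(1) N \<open>e > 0\<close> by (intro mult_strict_left_mono) (simp_all add: field_simps)
    also have "f (lcomb 1 x (l + h) w) - f (lcomb 1 x l w) - h * inn d g w
        = h * ((f (lcomb 1 x (l + h) w) - f (lcomb 1 x l w)) / h - inn d g w)"
      using h(1) by (simp only: right_diff_distrib) simp
    finally have "\<bar>h\<bar> * \<bar>(f (lcomb 1 x (l + h) w) - f (lcomb 1 x l w)) / h - inn d g w\<bar> < \<bar>h\<bar> * e"
      by (simp only: abs_mult)
    then show ?thesis using h(1) by simp
  qed
  then show "\<exists>s>0. \<forall>h. h \<noteq> 0 \<and> norm (h - 0) < s \<longrightarrow>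
      norm ((f (lcomb 1 x (l + h) w) - f (lcomb 1 x l w)) / h - inn d g w) < e"
    using \<open>\<delta> > 0\<close> N by (intro exI[of _ "\<delta> / (?N + 1)"]) auto
qed

text \<open>Differentiating along the two segments from \<open>x\<close> to \<open>u\<close> and to \<open>v\<close> at once gives the bound
  also when \<open>x\<close> is a boundary point, where \<open>u - v\<close> need not be a feasible direction.\<close>

lemma gradient_bound_on_differences:
  assumes "convex_set D" "D \<subseteq> rspace d" "has_grad d f g x"
    and lip: "\<forall>x\<in>D. \<forall>y\<in>D. \<bar>f x - f y\<bar> \<le> G * vnorm d (vdiff x y)"
    and xD: "x \<in> D" "u \<in> D" "v \<in> D"
  shows "\<bar>inn d g (vdiff u v)\<bar> \<le> G * vnorm d (vdiff u v)"
proof -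
  define F where "F u s = f (lcomb 1 x s (vdiff u x))" for u s
  have "lcomb 1 x 0 w = x" for w by (simp add: lcomb_def)
  then have deriv: "(F y has_field_derivative inn d g (vdiff y x)) (at 0)" if "y \<in> D" for y
    unfolding F_def using assms that by (intro has_grad_line) (auto intro: rspace_vdiff)
  have eq: "inn d g (vdiff u v) = inn d g (vdiff u x) - inn d g (vdiff v x)"
    by (simp add: vdiff_eq_lcomb inn_lcomb_right)
  have "((\<lambda>s. F u s - F v s) has_field_derivative inn d g (vdiff u v)) (at 0)"
    unfolding eq using xD by (intro DERIV_diff deriv)
  then have "((\<lambda>h. (F u h - F v h) / h) \<longlongrightarrow> inn d g (vdiff u v)) (at 0)"
    by (simp add: DERIV_def F_def lcomb_def)
  then have lim: "((\<lambda>h. \<bar>(F u h - F v h) / h\<bar>) \<longlongrightarrow> \<bar>inn d g (vdiff u v)\<bar>) (at_right 0)"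
    by (intro tendsto_rabs) (rule tendsto_within_subset, auto)
  have "\<bar>(F u h - F v h) / h\<bar> \<le> G * vnorm d (vdiff u v)" if h: "0 < h" "h < 1" for h
  proof -
    have "\<bar>F u h - F v h\<bar> \<le> G * vnorm d (vdiff (lcomb 1 x h (vdiff u x)) (lcomb 1 x h (vdiff v x)))"
      unfolding F_def using assms h by (intro lip[rule_format] segment_in_convex_set) auto
    also have "vdiff (lcomb 1 x h (vdiff u x)) (lcomb 1 x h (vdiff v x)) = vscale h (vdiff u v)"
      by (simp add: vdiff_def lcomb_def vscale_def algebra_simps)
    finally show ?thesis using h by (simp add: vnorm_vscale field_simps)
  qed
  then have "eventually (\<lambda>h. \<bar>(F u h - F v h) / h\<bar> \<le> G * vnorm d (vdiff u v)) (at_right 0)"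
    by (intro eventually_at_rightI[of 0 1]) auto
  with lim show ?thesis by (intro tendsto_upperbound) auto
qed

text \<open>The quadratic lower bound at a pair of points does not imply this inequality for the same pair.
  Along the segment, with \<open>a s\<close> the slope at \<open>s\<close>, it gives \<open>a r - a 0 \<ge> \<alpha> r a 0 a r\<close>, hence
  \<open>a r \<ge> a 0 / (1 - \<alpha> r a 0)\<close>, which is integrated.\<close>

lemma exp_concave_supporting:
  assumes "convex_set D" "D \<subseteq> rspace d" "\<alpha> > 0" "\<forall>x\<in>D. has_grad d f (gr x) x"
    and ec: "exp_concave d \<alpha> D f gr" and xD: "x \<in> D" "y \<in> D"
  shows "exp (- \<alpha> * f y) \<le> exp (- \<alpha> * f x) * (1 - \<alpha> * inn d (vdiff y x) (gr x))"
proof -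
  define w where "w = vdiff y x"
  define p where "p s = lcomb 1 x s w" for s
  define a where "a s = inn d (gr (p s)) w" for s
  have pD: "p s \<in> D" if "0 \<le> s" "s \<le> 1" for s
    unfolding p_def w_def using assms that by (intro segment_in_convex_set)
  have p0: "p 0 = x" and p1: "p 1 = y"
    by (simp_all add: p_def lcomb_def w_def vdiff_def)
  have lower: "f (p r) \<ge> f (p s) + (r - s) * a s + \<alpha> / 2 * ((r - s) * a s)\<^sup>2"
    if "0 \<le> s" "s \<le> 1" "0 \<le> r" "r \<le> 1" for r s
  proof -
    have "vdiff (p r) (p s) = vscale (r - s) w"
      by (simp add: vdiff_def p_def lcomb_def vscale_def algebra_simps)
    then have "inn d (vdiff (p r) (p s)) (gr (p s)) = (r - s) * a s"
      by (simp add: vscale_eq_lcomb inn_lcomb_left a_def inn_commute[of d w])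
    then show ?thesis using ec pD that unfolding exp_concave_def by metis
  qed
  have slope: "a 0 \<le> a r * (1 - \<alpha> * r * a 0)" if r: "0 \<le> r" "r \<le> 1" for r
  proof (cases "r = 0")
    case False
    then have "r > 0" using r by simp
    \<comment> \<open>The two lower bounds, from 0 to \<open>r\<close> and back, are added so that
      the losses cancel.\<close>
    have "r * (a 0 - a r) + \<alpha> / 2 * (r\<^sup>2 * ((a 0)\<^sup>2 + (a r)\<^sup>2)) \<le> 0"
      using lower[of 0 r] lower[of r 0] r by (simp add: algebra_simps power_mult_distrib)
    moreover have "\<alpha> / 2 * (r\<^sup>2 * ((a 0)\<^sup>2 + (a r)\<^sup>2)) \<ge> \<alpha> / 2 * (r\<^sup>2 * (2 * a 0 * a r))"
      using assms(3) sum_squares_bound[of "a 0" "a r"] by (intro mult_left_mono) auto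
    ultimately have "r * (a 0 - a r + \<alpha> * r * a 0 * a r) \<le> 0"
      by (simp add: algebra_simps power2_eq_square)
    then have "a 0 - a r + \<alpha> * r * a 0 * a r \<le> 0" using \<open>r > 0\<close> by (simp add: mult_le_0_iff)
    then show ?thesis by (simp add: algebra_simps)
  qed simp
  have pos: "1 - \<alpha> * r * a 0 > 0" if r: "0 \<le> r" "r \<le> 1" for r
  proof (rule ccontr)
    assume "\<not> 1 - \<alpha> * r * a 0 > 0"
    then have ge: "\<alpha> * r * a 0 \<ge> 1" by simp
    then have a0: "a 0 > 0" using assms(3) r
      by (smt (verit) mult_nonneg_nonneg mult_nonneg_nonpos)
    \<comment> \<open>At \<open>q\<close> the factor in \<open>slope\<close> vanishes, which would
      force \<open>a 0 \<le> 0\<close>.\<close>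
    define q where "q = 1 / (\<alpha> * a 0)"
    have "q \<ge> 0" using a0 assms(3) by (simp add: q_def)
    moreover have "q \<le> r" using a0 assms(3) ge by (simp add: q_def field_simps)
    ultimately have "a 0 \<le> a q * (1 - \<alpha> * q * a 0)" using slope r by simp
    also have "\<alpha> * q * a 0 = 1" using a0 assms(3) by (simp add: q_def)
    finally show False using a0 by simp
  qed
  \<comment> \<open>The second summand is minus an antiderivative of the lower bound for the slope,
    so \<open>H\<close> is nondecreasing.\<close>
  define H where "H s = f (p s) + ln (1 - \<alpha> * s * a 0) / \<alpha>" for s
  have "H 0 \<le> H 1"
  proof (rule DERIV_nonneg_imp_nondecreasing[where f = H])
    fix s :: real assume s: "0 \<le> s" "s \<le> 1"
    have "((\<lambda>s. f (p s)) has_field_derivative a s) (at s)"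
      unfolding p_def a_def
      by (rule has_grad_line) (use assms(2,4) xD pD[OF s] in \<open>auto simp: p_def w_def intro: rspace_vdiff\<close>)
    then have "(H has_field_derivative a s + (- (\<alpha> * a 0)) / (1 - \<alpha> * s * a 0) / \<alpha>) (at s)"
      unfolding H_def using pos[OF s] by (auto intro!: derivative_eq_intros)
    moreover have "0 \<le> a s + (- (\<alpha> * a 0)) / (1 - \<alpha> * s * a 0) / \<alpha>"
    proof -
      have "a 0 / (1 - \<alpha> * s * a 0) \<le> a s"
        using slope[OF s] pos[OF s] by (simp add: pos_divide_le_eq)
      then show ?thesis using assms(3) by simp
    qed
    ultimately show "\<exists>y. (H has_real_derivative y) (at s) \<and> 0 \<le> y" by blast
  qed simp
  then have "\<alpha> * f x \<le> \<alpha> * f y + ln (1 - \<alpha> * a 0)"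
    using assms(3) by (simp add: H_def p0 p1 field_simps)
  then have "- \<alpha> * f y \<le> - \<alpha> * f x + ln (1 - \<alpha> * a 0)" by simp
  then have "exp (- \<alpha> * f y) \<le> exp (- \<alpha> * f x + ln (1 - \<alpha> * a 0))" by simp
  also have "\<dots> = exp (- \<alpha> * f x) * (1 - \<alpha> * a 0)"
    unfolding exp_add using pos[of 1] by simp
  finally show ?thesis by (simp add: a_def p0 w_def inn_commute)
qed

text \<open>For nonempty convex \<open>D\<close> this is the linear span of the differences.
  Nonnegative factors reach all of it because exchanging \<open>u\<close> and \<open>v\<close>
  reverses the sign, and they allow sums to be written with convex combinations.\<close>

definition direction_space :: "vect set \<Rightarrow> vect set" where
  "direction_space D = {vscale c (vdiff u v) | c u v. 0 \<le> c \<and> u \<in> D \<and> v \<in> D}"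

lemma direction_space_vdiff:
  assumes "u \<in> D" "v \<in> D"
  shows "vscale c (vdiff u v) \<in> direction_space D"
proof (cases "c \<ge> 0")
  case True
  then show ?thesis using assms by (auto simp: direction_space_def)
next
  case False
  have "vscale c (vdiff u v) = vscale (- c) (vdiff v u)"
    by (simp add: vscale_def vdiff_def algebra_simps)
  moreover have "- c \<ge> 0" using False by simp
  ultimately show ?thesis using assms unfolding direction_space_def by blast
qed

text \<open>A sum of two scaled differences, \<open>k * (p - q) + k' * (p' - q')\<close>, is
  \<open>k + k'\<close> times the difference of two convex combinations with weights proportional to
  \<open>k\<close> and \<open>k'\<close>.\<close>

lemma lin_subspace_direction_space:
  assumes "convex_set D" "D \<subseteq> rspace d" "D \<noteq> {}"
  shows "lin_subspace d (direction_space D)"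
  unfolding lin_subspace_def
proof (intro conjI ballI allI)
  show "direction_space D \<subseteq> rspace d"
    using assms(2) by (auto simp: direction_space_def vscale_eq_lcomb intro!: rspace_lcomb rspace_vdiff)
  show "direction_space D \<noteq> {}" using assms(3) by (auto simp: direction_space_def)
  fix x y a b assume "x \<in> direction_space D" "y \<in> direction_space D"
  then obtain c u v c' u' v' where x: "x = vscale c (vdiff u v)" "u \<in> D" "v \<in> D"
    and y: "y = vscale c' (vdiff u' v')" "u' \<in> D" "v' \<in> D"
    by (auto simp: direction_space_def)
  have norm: "\<exists>k p q. 0 \<le> k \<and> p \<in> D \<and> q \<in> D \<and> vscale r (vdiff u v) = vscale k (vdiff p q)"
    if "u \<in> D" "v \<in> D" for r u v
    using direction_space_vdiff[OF that, of r] by (auto simp: direction_space_def)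
  obtain k p q where k: "0 \<le> k" "p \<in> D" "q \<in> D" "vscale (a * c) (vdiff u v) = vscale k (vdiff p q)"
    using norm x by blast
  obtain k' p' q' where k': "0 \<le> k'" "p' \<in> D" "q' \<in> D" "vscale (b * c') (vdiff u' v') = vscale k' (vdiff p' q')"
    using norm y by blast
  have "lcomb a x b y = lcomb 1 (vscale (a * c) (vdiff u v)) 1 (vscale (b * c') (vdiff u' v'))"
    by (simp add: x y lcomb_def vscale_def mult.assoc)
  also have "\<dots> = lcomb 1 (vscale k (vdiff p q)) 1 (vscale k' (vdiff p' q'))" using k k' by simp
  also have "\<dots> \<in> direction_space D"
  proof (cases "k + k' = 0")
    case True
    then have "k = 0" "k' = 0" using k(1) k'(1) by auto
    then have "lcomb 1 (vscale k (vdiff p q)) 1 (vscale k' (vdiff p' q')) = vscale 0 (vdiff p p)"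
      by (simp add: lcomb_def vscale_def)
    then show ?thesis using direction_space_vdiff k by metis
  next
    case False
    then have K: "k + k' > 0" using k(1) k'(1) by simp
    define t where "t = k / (k + k')"
    have t: "0 \<le> t" "t \<le> 1" and kt: "k = (k + k') * t" "k' = (k + k') * (1 - t)"
      using K k(1) k'(1) by (simp_all add: t_def field_simps)
    have mem: "(\<lambda>i. t * p i + (1 - t) * p' i) \<in> D" "(\<lambda>i. t * q i + (1 - t) * q' i) \<in> D"
      using assms(1) t k k' by (simp_all add: convex_set_def)
    have "lcomb 1 (vscale k (vdiff p q)) 1 (vscale k' (vdiff p' q'))
      = vscale (k + k') (vdiff (\<lambda>i. t * p i + (1 - t) * p' i) (\<lambda>i. t * q i + (1 - t) * q' i))"
    proof (rule ext)
      fix i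
      have "k * (p i - q i) = (k + k') * t * (p i - q i)"
        "k' * (p' i - q' i) = (k + k') * (1 - t) * (p' i - q' i)"
        using kt by simp_all
      then show "lcomb 1 (vscale k (vdiff p q)) 1 (vscale k' (vdiff p' q')) i
        = vscale (k + k') (vdiff (\<lambda>i. t * p i + (1 - t) * p' i) (\<lambda>i. t * q i + (1 - t) * q' i)) i"
        unfolding lcomb_def vscale_def vdiff_def by (simp only: mult_1) (simp add: algebra_simps)
    qed
    then show ?thesis using direction_space_vdiff[OF mem] by metis
  qed
  finally show "lcomb a x b y \<in> direction_space D" .
qed

lemma direction_space_bound:
  assumes "\<And>u v. u \<in> D \<Longrightarrow> v \<in> D \<Longrightarrow> \<bar>inn d g (vdiff u v)\<bar> \<le> G * vnorm d (vdiff u v)"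
    and "w \<in> direction_space D"
  shows "\<bar>inn d g w\<bar> \<le> G * vnorm d w"
proof -
  obtain c u v where w: "w = vscale c (vdiff u v)" "0 \<le> c" "u \<in> D" "v \<in> D"
    using assms(2) by (auto simp: direction_space_def)
  have "\<bar>inn d g w\<bar> = c * \<bar>inn d g (vdiff u v)\<bar>"
    using w(2) by (simp add: w(1) vscale_eq_lcomb inn_lcomb_right abs_mult)
  also have "\<dots> \<le> c * (G * vnorm d (vdiff u v))" using assms(1) w by (intro mult_left_mono)
  also have "\<dots> = G * vnorm d w" using w(2) by (simp add: w(1) vnorm_vscale)
  finally show ?thesis .
qed

subsection \<open>Follow the Leading History\<close>

lemma flh_w_Suc:
  assumes "t \<ge> 1"
  shows "flh_w \<zeta> f P (Suc t) i =
    (if 1 \<le> i \<and> i \<le> t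
     then (1 - 1 / real (t + 1)) * (flh_w \<zeta> f P t i * exp (- \<zeta> * f t (P i t))
            / (\<Sum>j=1..t. flh_w \<zeta> f P t j * exp (- \<zeta> * f t (P j t))))
     else if i = t + 1 then 1 / real (t + 1) else 0)"
  using assms by (cases t) (simp_all add: Let_def)

lemma flh_w_pos: "1 \<le> j \<Longrightarrow> j \<le> t \<Longrightarrow> flh_w \<zeta> f P t j > 0"
proof (induction t arbitrary: j)
  case 0
  then show ?case by simp
next
  case (Suc t)
  show ?case
  proof (cases "t = 0")
    case True
    then show ?thesis using Suc.prems by simp
  next
    case False
    have "(\<Sum>i=1..t. flh_w \<zeta> f P t i * exp (- \<zeta> * f t (P i t))) > 0"
      using False Suc.IH by (intro sum_pos) auto
    then show ?thesis using False Suc by (simp add: flh_w_Suc)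
  qed
qed

lemma flh_partition_pos:
  "t \<ge> 1 \<Longrightarrow> (\<Sum>i=1..t. flh_w \<zeta> f P t i * exp (- \<zeta> * f t (P i t))) > 0"
  by (intro sum_pos) (auto simp: flh_w_pos)

lemma flh_w_sum: "t \<ge> 1 \<Longrightarrow> (\<Sum>j=1..t. flh_w \<zeta> f P t j) = 1"
proof (induction t rule: dec_induct)
  case base
  then show ?case by simp
next
  case (step t)
  let ?e = "\<lambda>j. flh_w \<zeta> f P t j * exp (- \<zeta> * f t (P j t))"
  let ?Z = "\<Sum>j=1..t. ?e j"
  have "?Z > 0" using flh_partition_pos[OF step.hyps(1)] .
  have "(\<Sum>j=1..Suc t. flh_w \<zeta> f P (Suc t) j)
      = (\<Sum>j=1..t. flh_w \<zeta> f P (Suc t) j) + 1 / real (t + 1)"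
    using step.hyps by (simp add: flh_w_Suc)
  also have "(\<Sum>j=1..t. flh_w \<zeta> f P (Suc t) j) = (\<Sum>j=1..t. (1 - 1 / real (t + 1)) * (?e j / ?Z))"
    using step.hyps by (intro sum.cong) (auto simp: flh_w_Suc)
  also have "\<dots> = (1 - 1 / real (t + 1)) * (?Z / ?Z)"
    by (simp only: sum_distrib_left sum_divide_distrib)
  finally show ?case using \<open>?Z > 0\<close> by simp
qed

lemma flh_w_self: "t \<ge> 1 \<Longrightarrow> flh_w \<zeta> f P t t = 1 / real t"
proof (cases "t = 1")
  case False
  assume "t \<ge> 1"
  with False obtain s where "t = Suc s" "s \<ge> 1" by (cases t) auto
  then show ?thesis by (simp add: flh_w_Suc)
qed simp

lemma flh_w_le_1: "1 \<le> j \<Longrightarrow> j \<le> t \<Longrightarrow> flh_w \<zeta> f P t j \<le> 1"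
  using member_le_sum[of j "{1..t}" "flh_w \<zeta> f P t"] flh_w_sum[of t \<zeta> f P]
  by (auto simp: flh_w_pos less_imp_le)

text \<open>\<open>convex_set\<close> speaks of two points at a time. Dividing by the total weight
  lets the induction append one point without renormalizing the weights.\<close>

lemma convex_set_sum_mem:
  fixes n :: nat
  assumes "convex_set D"
  shows "n \<ge> 1 \<Longrightarrow> (\<And>j. 1 \<le> j \<Longrightarrow> j \<le> n \<Longrightarrow> v j > (0::real) \<and> y j \<in> D)
    \<Longrightarrow> (\<lambda>i. (\<Sum>j=1..n. v j * y j i) / (\<Sum>j=1..n. v j)) \<in> D"
proof (induction n rule: dec_induct)
  case base
  then have "(\<lambda>i. (\<Sum>j=1..1. v j * y j i) / (\<Sum>j=1..1. v j)) = y 1"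
    by (auto simp: fun_eq_iff less_imp_neq)
  then show ?case using base by auto
next
  case (step n)
  let ?S = "\<lambda>n. \<Sum>j=1..n. v j"
  let ?y = "\<lambda>i. (\<Sum>j=1..n. v j * y j i) / ?S n"
  have y: "?y \<in> D" using step by auto
  have S: "?S n > 0" using step by (intro sum_pos) auto
  have v: "v (Suc n) > 0" "y (Suc n) \<in> D" using step.prems by auto
  define u where "u = ?S n / ?S (Suc n)"
  have u: "0 \<le> u" "u \<le> 1" "1 - u = v (Suc n) / ?S (Suc n)"
    using S v by (simp_all add: u_def field_simps)
  have "(\<lambda>i. u * ?y i + (1 - u) * y (Suc n) i) \<in> D"
    using assms[unfolded convex_set_def, rule_format, OF y v(2), of u] u(1,2) by simp
  also have "(\<lambda>i. u * ?y i + (1 - u) * y (Suc n) i)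
      = (\<lambda>i. (\<Sum>j=1..Suc n. v j * y j i) / ?S (Suc n))"
    unfolding u(3) using S v by (simp add: u_def fun_eq_iff add_divide_distrib)
  finally show ?case .
qed

lemma flh_play_mem:
  assumes "convex_set D" "t \<ge> 1" "\<And>j. 1 \<le> j \<Longrightarrow> j \<le> t \<Longrightarrow> P j t \<in> D"
  shows "flh_play \<zeta> f P t \<in> D"
proof -
  have "(\<lambda>i. (\<Sum>j=1..t. flh_w \<zeta> f P t j * P j t i) / (\<Sum>j=1..t. flh_w \<zeta> f P t j)) \<in> D"
    by (rule convex_set_sum_mem) (use assms flh_w_pos in auto)
  then show ?thesis unfolding flh_w_sum[OF assms(2)] by (simp add: flh_play_def)
qed

text \<open>Jensen's inequality for \<open>exp (- \<alpha> * f)\<close>, from its supporting hyperplane at the mean.\<close>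

lemma flh_mixture_loss:
  assumes "convex_set D" "t \<ge> 1" and P: "\<And>j. 1 \<le> j \<Longrightarrow> j \<le> t \<Longrightarrow> P j t \<in> D"
    and sup: "\<And>x y. x \<in> D \<Longrightarrow> y \<in> D \<Longrightarrow>
      exp (- \<alpha> * f t y) \<le> exp (- \<alpha> * f t x) * (1 - \<alpha> * inn d (vdiff y x) (gr x))"
  shows "(\<Sum>j=1..t. flh_w \<alpha> f P t j * exp (- \<alpha> * f t (P j t))) \<le> exp (- \<alpha> * f t (flh_play \<alpha> f P t))"
proof -
  let ?x = "flh_play \<alpha> f P t" and ?v = "flh_w \<alpha> f P t"
  let ?g = "gr ?x"
  have xD: "?x \<in> D" using flh_play_mem[of D t P] assms by blast
  have mean: "(\<Sum>j=1..t. ?v j * inn d (P j t) ?g) = inn d ?x ?g"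
    by (simp only: flh_play_def inn_sum_left)
  have "(\<Sum>j=1..t. ?v j * exp (- \<alpha> * f t (P j t)))
      \<le> (\<Sum>j=1..t. ?v j * (exp (- \<alpha> * f t ?x) * (1 - \<alpha> * inn d (vdiff (P j t) ?x) ?g)))"
    by (intro sum_mono mult_left_mono sup xD P) (auto simp: flh_w_pos less_imp_le)
  also have "\<dots> = exp (- \<alpha> * f t ?x) * ((\<Sum>j=1..t. ?v j) * (1 + \<alpha> * inn d ?x ?g)
      - \<alpha> * (\<Sum>j=1..t. ?v j * inn d (P j t) ?g))"
    by (simp add: vdiff_eq_lcomb inn_lcomb_left algebra_simps sum.distrib sum_subtractf
        sum_distrib_left sum_distrib_right)
  also have "\<dots> = exp (- \<alpha> * f t ?x)"
    unfolding mean flh_w_sum[OF assms(2)] by simp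
  finally show ?thesis .
qed

text \<open>The potential \<open>ln (t * v_t)\<close>, with \<open>v_t\<close> the weight of
  \<open>E^j\<close>, starts at 0 for \<open>t = j\<close>. The factor \<open>t\<close> cancels the
  mixing factor \<open>1 - 1 / (t + 1)\<close>, so a round changes it by minus
  \<open>\<alpha>\<close> times the loss of \<open>E^j\<close> minus the log-partition value, and
  the latter is bounded through the loss of the mixture.\<close>

lemma flh_regret_potential:
  assumes "convex_set D" "\<alpha> > 0" "j \<ge> 1"
    and P: "\<And>i t. 1 \<le> i \<Longrightarrow> i \<le> t \<Longrightarrow> t < j + n \<Longrightarrow> P i t \<in> D"
    and sup: "\<And>t x y. 1 \<le> t \<Longrightarrow> t < j + n \<Longrightarrow> x \<in> D \<Longrightarrow> y \<in> D \<Longrightarrow>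
      exp (- \<alpha> * f t y) \<le> exp (- \<alpha> * f t x) * (1 - \<alpha> * inn d (vdiff y x) (gr t x))"
  shows "k \<le> n \<Longrightarrow> (\<Sum>t=j..<j+k. \<alpha> * (f t (flh_play \<alpha> f P t) - f t (P j t)))
    \<le> ln (real (j + k) * flh_w \<alpha> f P (j + k) j)"
proof (induction k)
  case 0
  then show ?case using assms(3) by (simp add: flh_w_self)
next
  case (Suc k)
  define t where "t = j + k"
  have t: "1 \<le> t" "t < j + n" "j \<le> t" using Suc.prems assms(3) by (auto simp: t_def)
  let ?v = "flh_w \<alpha> f P t"
  let ?Z = "\<Sum>i=1..t. ?v i * exp (- \<alpha> * f t (P i t))"
  have Z: "?Z > 0" using flh_partition_pos[OF t(1)] .
  have vj: "?v j > 0" using flh_w_pos assms(3) t by blast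
  have "?Z \<le> exp (- \<alpha> * f t (flh_play \<alpha> f P t))"
    by (rule flh_mixture_loss[where D = D and d = d and gr = "gr t"]) (use assms t in auto)
  then have lnZ: "ln ?Z \<le> - \<alpha> * f t (flh_play \<alpha> f P t)"
    using Z by (metis ln_exp ln_mono)
  have "real (Suc t) * flh_w \<alpha> f P (Suc t) j = real t * ?v j * exp (- \<alpha> * f t (P j t)) / ?Z"
  proof -
    have "real (Suc t) * (1 - 1 / real (t + 1)) = real t" by (simp add: field_simps)
    then have "real (Suc t) * ((1 - 1 / real (t + 1)) * q) = real t * q" for q
      by (simp only: mult.assoc[symmetric])
    then show ?thesis using t assms(3) unfolding flh_w_Suc[OF t(1)] by simp
  qed
  then have "ln (real (Suc t) * flh_w \<alpha> f P (Suc t) j)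
      = ln (real t * ?v j) - \<alpha> * f t (P j t) - ln ?Z"
    using Z vj t by (simp add: ln_div ln_mult)
  with lnZ have "ln (real t * ?v j) + \<alpha> * (f t (flh_play \<alpha> f P t) - f t (P j t))
      \<le> ln (real (Suc t) * flh_w \<alpha> f P (Suc t) j)"
    by (simp add: algebra_simps)
  with Suc.IH Suc.prems show ?case by (simp add: t_def)
qed

lemma flh_regret:
  assumes "convex_set D" "\<alpha> > 0" "j \<ge> 1"
    and "\<And>i t. 1 \<le> i \<Longrightarrow> i \<le> t \<Longrightarrow> t < j + n \<Longrightarrow> P i t \<in> D"
    and "\<And>t x y. 1 \<le> t \<Longrightarrow> t < j + n \<Longrightarrow> x \<in> D \<Longrightarrow> y \<in> D \<Longrightarrow>
      exp (- \<alpha> * f t y) \<le> exp (- \<alpha> * f t x) * (1 - \<alpha> * inn d (vdiff y x) (gr t x))"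
  shows "(\<Sum>t=j..<j+n. f t (flh_play \<alpha> f P t) - f t (P j t)) \<le> ln (real (j + n)) / \<alpha>"
proof -
  have "(\<Sum>t=j..<j+n. \<alpha> * (f t (flh_play \<alpha> f P t) - f t (P j t)))
      \<le> ln (real (j + n) * flh_w \<alpha> f P (j + n) j)"
    by (rule flh_regret_potential[where D = D and d = d and gr = gr and n = n]) (use assms in auto)
  also have "\<dots> \<le> ln (real (j + n))"
    using assms(3) flh_w_pos[of j "j + n" \<alpha> f P] flh_w_le_1[of j "j + n" \<alpha> f P]
    by (subst ln_le_cancel_iff) auto
  finally show ?thesis
    using assms(2) by (simp only: sum_distrib_left[symmetric] pos_le_divide_eq mult.commute)
qed

subsection \<open>Regret of the Online Newton Step\<close>

text \<open>Each extension of a history writes only the next time, so histories of different lengths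
  agree on the times they share.\<close>

lemma ons_hist_eq_pred:
  "j \<le> s \<Longrightarrow> s \<le> j + n \<Longrightarrow> ons_hist d D gr \<gamma> \<epsilon> x j n s = ons_pred d D gr \<gamma> \<epsilon> x j s"
proof (induction n)
  case 0
  then show ?case by (simp add: ons_pred_def)
next
  case (Suc n)
  show ?case
  proof (cases "s = j + Suc n")
    case True
    then show ?thesis by (simp add: ons_pred_def del: ons_hist.simps)
  next
    case False
    then show ?thesis using Suc by (simp add: Let_def)
  qed
qed

lemma ons_pred_Suc:
  assumes "j \<le> t"
  shows "ons_pred d D gr \<gamma> \<epsilon> x j (Suc t) =
    ons_step d D \<gamma> \<epsilon> (map (\<lambda>s. gr s (ons_pred d D gr \<gamma> \<epsilon> x j s)) [j..<Suc t])
      (gr t (ons_pred d D gr \<gamma> \<epsilon> x j t)) (ons_pred d D gr \<gamma> \<epsilon> x j t)"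
proof -
  define n where "n = t - j"
  have t: "t = j + n" using assms by (simp add: n_def)
  have "map (\<lambda>s. gr s (ons_hist d D gr \<gamma> \<epsilon> x j n s)) [j..<Suc t]
      = map (\<lambda>s. gr s (ons_pred d D gr \<gamma> \<epsilon> x j s)) [j..<Suc t]"
    unfolding t by (intro map_cong refl) (auto simp: ons_hist_eq_pred)
  moreover have "ons_hist d D gr \<gamma> \<epsilon> x j n t = ons_pred d D gr \<gamma> \<epsilon> x j t"
    by (simp add: ons_pred_def t)
  moreover have "ons_pred d D gr \<gamma> \<epsilon> x j (Suc t) = ons_hist d D gr \<gamma> \<epsilon> x j (Suc n) (Suc t)"
    by (simp only: ons_pred_def) (simp add: t)
  ultimately show ?thesis by (simp add: Let_def t[symmetric] del: upt_Suc map_eq_conv)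
qed

section \<open>The setting of the theorem for one instance, and the regret of the base learners in
  it\<close>

locale flh_ons =
  fixes d T :: nat and D :: "vect set" and f :: "nat \<Rightarrow> vect \<Rightarrow> real" and gr :: "nat \<Rightarrow> vect \<Rightarrow> vect"
    and x0 :: "nat \<Rightarrow> vect" and G Dd \<alpha> :: real
  assumes G_pos: "G > 0" and Dd_pos: "Dd > 0" and alpha_pos: "\<alpha> > 0"
    and D_rspace: "D \<subseteq> rspace d" and D_nonempty: "D \<noteq> {}"
    and D_convex: "convex_set D" and D_closed: "closed D"
    and D_diam: "\<forall>x\<in>D. \<forall>y\<in>D. vnorm d (vdiff x y) \<le> Dd"
    and grad: "\<And>t x. t \<in> {1..T} \<Longrightarrow> x \<in> D \<Longrightarrow> has_grad d (f t) (gr t x) x"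
    and f_exp_concave: "\<And>t. t \<in> {1..T} \<Longrightarrow> exp_concave d \<alpha> D (f t) (gr t)"
    and f_lipschitz: "\<And>t. t \<in> {1..T} \<Longrightarrow> \<forall>x\<in>D. \<forall>y\<in>D. \<bar>f t x - f t y\<bar> \<le> G * vnorm d (vdiff x y)"
    and x0_mem: "\<And>j. x0 j \<in> D"
begin

abbreviation "\<gamma> \<equiv> ons_gamma G Dd \<alpha>"
abbreviation "\<epsilon> \<equiv> ons_eps G Dd \<alpha>"
abbreviation "pred j \<equiv> ons_pred d D gr \<gamma> \<epsilon> (x0 j) j"

text \<open>\<open>gamma_le\<close> weakens the quadratic term of exp-concavity to the factor
  \<open>\<gamma>\<close>, and \<open>gamma_GD\<close> makes \<open>G^2 / \<epsilon>\<close> at most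
  1 in the logarithm.\<close>

lemma gamma_pos: "\<gamma> > 0" and gamma_le: "\<gamma> \<le> \<alpha> / 2" and gamma_GD: "\<gamma> * (G * Dd) \<le> 1"
proof -
  show "\<gamma> > 0" "\<gamma> \<le> \<alpha> / 2" using G_pos Dd_pos alpha_pos by (auto simp: ons_gamma_def)
  have "\<gamma> \<le> 1 / 2 * (1 / (4 * G * Dd))"
    unfolding ons_gamma_def by (intro mult_left_mono) auto
  then have "\<gamma> \<le> 1 / (8 * (G * Dd))" by (simp add: mult.assoc)
  then have "\<gamma> * (G * Dd) \<le> 1 / (8 * (G * Dd)) * (G * Dd)"
    using G_pos Dd_pos by (intro mult_right_mono) auto
  also have "\<dots> \<le> 1" using G_pos Dd_pos by simp
  finally show "\<gamma> * (G * Dd) \<le> 1" .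
qed

lemma eps_pos: "\<epsilon> > 0"
  using gamma_pos Dd_pos by (simp add: ons_eps_def)

lemma grad_rspace: "t \<in> {1..T} \<Longrightarrow> x \<in> D \<Longrightarrow> gr t x \<in> rspace d"
  using grad by (auto simp: has_grad_def)

lemma grad_bound:
  assumes "t \<in> {1..T}" "x \<in> D" "w \<in> direction_space D"
  shows "\<bar>inn d (gr t x) w\<bar> \<le> G * vnorm d w"
proof (rule direction_space_bound[OF _ assms(3)])
  show "\<bar>inn d (gr t x) (vdiff u v)\<bar> \<le> G * vnorm d (vdiff u v)" if "u \<in> D" "v \<in> D" for u v
    using gradient_bound_on_differences[OF D_convex D_rspace grad[OF assms(1,2)] f_lipschitz[OF assms(1)]]
      that assms(2) by blast
qed

text \<open>Gradients are controlled only at points of \<open>D\<close>, so membership of the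
  predictions so far is assumed here and supplied by the induction in
  \<open>pred_mem\<close>.\<close>

lemma pred_step:
  assumes "j \<ge> 1" "j \<le> t" "t \<le> T" and mem: "\<And>s. j \<le> s \<Longrightarrow> s \<le> t \<Longrightarrow> pred j s \<in> D"
  defines "gs \<equiv> map (\<lambda>s. gr s (pred j s)) [j..<Suc t]"
  shows "pred j (Suc t) \<in> D"
    and "u \<in> D \<Longrightarrow> 0 \<le> bil d \<epsilon> gs (vdiff (pred j (Suc t)) (pred j t)) (vdiff u (pred j (Suc t)))
      + inn d (gr t (pred j t)) (vdiff u (pred j (Suc t))) / \<gamma>"
proof -
  have gs: "set gs \<subseteq> rspace d"
    using assms mem grad_rspace by (auto simp: gs_def less_Suc_eq_le simp del: upt_Suc)
  have gt: "gr t (pred j t) \<in> rspace d" using assms mem grad_rspace by auto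
  note step = ons_step_variational[OF eps_pos D_closed D_rspace D_diam D_convex gs gt mem[OF assms(2) order_refl],
      where \<gamma> = \<gamma>, folded ons_pred_Suc[OF assms(2), of d D gr \<gamma> \<epsilon> "x0 j", folded gs_def]]
  show "pred j (Suc t) \<in> D" by (rule step(1))
  show "u \<in> D \<Longrightarrow> 0 \<le> bil d \<epsilon> gs (vdiff (pred j (Suc t)) (pred j t)) (vdiff u (pred j (Suc t)))
      + inn d (gr t (pred j t)) (vdiff u (pred j (Suc t))) / \<gamma>" by (rule step(2))
qed

text \<open>Losses end at round \<open>T\<close>, but the telescoping sum refers to the prediction
  made after it, hence the range up to \<open>Suc T\<close>.\<close>

lemma pred_mem:
  assumes "j \<ge> 1" "j \<le> t" "t \<le> Suc T"
  shows "pred j t \<in> D"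
proof -
  have "t \<le> Suc T \<longrightarrow> (\<forall>s. j \<le> s \<and> s \<le> t \<longrightarrow> pred j s \<in> D)"
    using assms(2)
  proof (induction t rule: dec_induct)
    case base
    then show ?case using x0_mem by (auto simp: ons_pred_def)
  next
    case (step t)
    then show ?case using pred_step(1)[OF assms(1), of t] by (auto simp: le_Suc_eq)
  qed
  then show ?thesis using assms by blast
qed

text \<open>The linearized regret splits into a part at the next iterate, bounded by the variational
  inequality, and the movement of the iterate. Scaling this movement by \<open>\<gamma>\<close>
  gives it the shape handled by the elliptical potential.\<close>

lemma ons_regret_step:
  assumes "j \<ge> 1" "j \<le> t" "t \<le> T" "u \<in> D"
  defines "g \<equiv> \<lambda>s. gr s (pred j s)"
  defines "N \<equiv> \<lambda>t. bil d \<epsilon> (map g [j..<t]) (vdiff (pred j t) u) (vdiff (pred j t) u)"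
  defines "c \<equiv> vscale \<gamma> (vdiff (pred j t) (pred j (Suc t)))"
  shows "f t (pred j t) - f t u \<le> \<gamma> / 2 * (N t - N (Suc t))
    + 1 / (2 * \<gamma>) * (2 * inn d (g t) c - bil d \<epsilon> (map g [j..<Suc t]) c c)"
proof -
  define x x' where "x = pred j t" and "x' = pred j (Suc t)"
  let ?B = "bil d \<epsilon> (map g [j..<Suc t])"
  let ?w = "vdiff x x'"
  define a where "a = inn d (g t) (vdiff x u)"
  have xD: "x \<in> D" using pred_mem assms by (simp add: x_def)
  have var: "0 \<le> ?B (vdiff x' x) (vdiff u x') + inn d (g t) (vdiff u x') / \<gamma>"
    using pred_step(2)[OF assms(1-3) _ assms(4)] pred_mem assms(1,3)
    by (simp add: x_def x'_def g_def del: upt_Suc)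
  \<comment> \<open>Three-point identity for the form, with the points \<open>x\<close>,
    \<open>x'\<close> and \<open>u\<close>.\<close>
  have "?B (vdiff x u) (vdiff x u) - ?B (vdiff x' u) (vdiff x' u) - ?B ?w ?w = 2 * ?B (vdiff x' x) (vdiff u x')"
    using bil_commute[of d \<epsilon> "map g [j..<Suc t]" u x] bil_commute[of d \<epsilon> "map g [j..<Suc t]" u x']
      bil_commute[of d \<epsilon> "map g [j..<Suc t]" x' x]
    by (simp add: vdiff_eq_lcomb bil_lcomb_left bil_lcomb_right algebra_simps del: upt_Suc)
  then have "\<gamma> / 2 * (?B (vdiff x u) (vdiff x u) - ?B (vdiff x' u) (vdiff x' u) - ?B ?w ?w)
      = \<gamma> * ?B (vdiff x' x) (vdiff u x')" by simp
  also have "\<dots> \<ge> - inn d (g t) (vdiff u x')"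
    using var gamma_pos by (simp add: field_simps del: upt_Suc)
  finally have 1: "- inn d (g t) (vdiff u x')
      \<le> \<gamma> / 2 * (?B (vdiff x u) (vdiff x u) - ?B (vdiff x' u) (vdiff x' u) - ?B ?w ?w)" .
  have 2: "a = - inn d (g t) (vdiff u x') + inn d (g t) ?w"
    by (simp add: a_def vdiff_eq_lcomb inn_lcomb_right)
  \<comment> \<open>The form of this round contains the new gradient; the resulting square is paid
    for by exp-concavity.\<close>
  have 3: "?B (vdiff x u) (vdiff x u) = N t + a\<^sup>2"
    using assms(2) by (simp add: N_def a_def x_def bil_append power2_eq_square)
  have 4: "N (Suc t) = ?B (vdiff x' u) (vdiff x' u)" by (simp only: N_def x'_def)
  have 5: "1 / (2 * \<gamma>) * (2 * inn d (g t) c - ?B c c) = inn d (g t) ?w - \<gamma> / 2 * ?B ?w ?w"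
    using gamma_pos unfolding c_def x_def[symmetric] x'_def[symmetric] vscale_eq_lcomb
    by (simp add: inn_lcomb_right bil_lcomb_left bil_lcomb_right field_simps del: upt_Suc)
  have "inn d (vdiff u x) (g t) = - a"
    by (simp add: a_def vdiff_eq_lcomb inn_lcomb_left inn_lcomb_right inn_commute[of d _ "g t"])
  then have "f t x - f t u \<le> a - \<alpha> / 2 * a\<^sup>2"
    using f_exp_concave[of t] xD assms(1-4) unfolding exp_concave_def
    by (force simp: g_def x_def)
  also have "\<dots> \<le> a - \<gamma> / 2 * a\<^sup>2"
    using gamma_le gamma_pos by (intro diff_left_mono mult_right_mono) auto
  also have "\<dots> \<le> \<gamma> / 2 * (N t - N (Suc t)) + 1 / (2 * \<gamma>) * (2 * inn d (g t) c - ?B c c)"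
    using 1 unfolding 2 3[unfolded 2] 4 5 by (simp add: algebra_simps del: upt_Suc)
  finally show ?thesis by (simp only: x_def)
qed

lemma ons_regret:
  assumes "j \<ge> 1" "j + n \<le> Suc T" "u \<in> D"
  shows "(\<Sum>t=j..<j+n. f t (pred j t) - f t u) \<le> (1 + real d * ln (1 + real T)) / (2 * \<gamma>)"
proof -
  define g where "g s = gr s (pred j s)" for s
  define N where "N t = bil d \<epsilon> (map g [j..<t]) (vdiff (pred j t) u) (vdiff (pred j t) u)" for t
  define c where "c t = vscale \<gamma> (vdiff (pred j t) (pred j (Suc t)))" for t
  have "(\<Sum>t=j..<j+n. f t (pred j t) - f t u)
      \<le> (\<Sum>t=j..<j+n. \<gamma> / 2 * (N t - N (Suc t))
          + 1 / (2 * \<gamma>) * (2 * inn d (g t) (c t) - bil d \<epsilon> (map g [j..<Suc t]) (c t) (c t)))"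
    unfolding N_def g_def c_def using assms by (intro sum_mono ons_regret_step) auto
  also have "\<dots> = \<gamma> / 2 * (\<Sum>t=j..<j+n. N t - N (Suc t))
      + 1 / (2 * \<gamma>) * (\<Sum>t=j..<j+n. 2 * inn d (g t) (c t) - bil d \<epsilon> (map g [j..<Suc t]) (c t) (c t))"
    by (simp only: sum.distrib sum_distrib_left)
  also have "(\<Sum>t=j..<j+n. N t - N (Suc t)) = N j - N (j + n)"
    by (induction n) simp_all
  also have "N j - N (j + n) \<le> \<epsilon> * Dd\<^sup>2"
  proof -
    have "N (j + n) \<ge> 0"
      unfolding N_def using eps_pos inn_self_nonneg
      by (intro order_trans[OF _ bil_self_ge]) simp
    have "inn d (vdiff (pred j j) u) (vdiff (pred j j) u) \<le> Dd\<^sup>2"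
      unfolding vnorm_sq[symmetric] using D_diam pred_mem[of j j] assms Dd_pos
      by (intro power_mono) (auto simp: vnorm_nonneg x0_mem ons_pred_def)
    then have "N j \<le> \<epsilon> * Dd\<^sup>2" using eps_pos by (simp add: N_def bil_Nil)
    with \<open>N (j + n) \<ge> 0\<close> show ?thesis by linarith
  qed
  also have "(\<Sum>t=j..<j+n. 2 * inn d (g t) (c t) - bil d \<epsilon> (map g [j..<Suc t]) (c t) (c t))
      \<le> real d * ln (1 + real T)"
  proof -
    have "(\<Sum>t=j..<j+n. 2 * inn d (g t) (c t) - bil d \<epsilon> (map g [j..<Suc t]) (c t) (c t))
        \<le> real d * ln (1 + real n * G\<^sup>2 / \<epsilon>)"
    proof (rule elliptical_potential_subspace[OF eps_pos
          lin_subspace_direction_space[OF D_convex D_rspace D_nonempty]])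
      fix t assume t: "t \<in> {j..<j+n}"
      then have mem: "pred j t \<in> D" "pred j (Suc t) \<in> D" using assms by (auto intro: pred_mem)
      then show "c t \<in> direction_space D" by (simp add: c_def direction_space_vdiff)
      show "\<bar>inn d (g t) w\<bar> \<le> G * vnorm d w" if "w \<in> direction_space D" for w
        unfolding g_def using t assms that mem by (intro grad_bound) auto
    qed
    also have "\<dots> \<le> real d * ln (1 + real T)"
    proof -
      have "G\<^sup>2 / \<epsilon> = (\<gamma> * (G * Dd))\<^sup>2" by (simp add: ons_eps_def power_mult_distrib)
      also have "\<dots> \<le> 1" using gamma_GD gamma_pos G_pos Dd_pos by (intro power_le_one) auto
      finally have "real n * (G\<^sup>2 / \<epsilon>) \<le> real n * 1" by (intro mult_left_mono) auto
      moreover have "n \<le> T" using assms by simp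
      ultimately have "1 + real n * G\<^sup>2 / \<epsilon> \<le> 1 + real T" by simp
      moreover have "0 < 1 + real n * G\<^sup>2 / \<epsilon>" using eps_pos by (intro add_pos_nonneg) auto
      ultimately show ?thesis by (intro mult_left_mono ln_mono) auto
    qed
    finally show ?thesis .
  qed
  finally have "(\<Sum>t=j..<j+n. f t (pred j t) - f t u)
      \<le> \<gamma> / 2 * (\<epsilon> * Dd\<^sup>2) + 1 / (2 * \<gamma>) * (real d * ln (1 + real T))"
    using gamma_pos by (simp add: divide_right_mono)
  \<comment> \<open>The choice of \<open>\<epsilon>\<close> makes the initial distance cost
    \<open>1 / (2 * \<gamma>)\<close>.\<close>
  also have "\<gamma> / 2 * (\<epsilon> * Dd\<^sup>2) = 1 / (2 * \<gamma>)"
    using gamma_pos Dd_pos by (simp add: ons_eps_def power2_eq_square)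
  finally show ?thesis by (simp add: add_divide_distrib)
qed

text \<open>Regret of FLH against \<open>E^j\<close> plus regret of \<open>E^j\<close> against
  \<open>u\<close>, where \<open>j\<close> is the first round of the interval, so that
  \<open>E^j\<close> starts exactly there.\<close>

lemma adaptive_regret:
  assumes "d \<ge> 1" "T \<ge> 1" "j \<ge> 1" "j + n \<le> Suc T" "u \<in> D"
  shows "(\<Sum>t=j..<j+n. f t (flh_ons_play d D G Dd \<alpha> f gr x0 t) - f t u)
    \<le> (1 / \<gamma> + 1 / \<alpha>) * (real d * (1 + ln (real T)))"
proof -
  let ?x = "flh_ons_play d D G Dd \<alpha> f gr x0"
  let ?L = "1 + ln (real T)"
  \<comment> \<open>All logarithms are absorbed into \<open>1 + ln T\<close>, using
    \<open>ln 2 < 1\<close>; unlike \<open>ln T\<close>, this is at least 1 already for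
    \<open>T = 1\<close>.\<close>
  have "ln (1 + real T) \<le> ln (2 * real T)" using assms(2) by (intro ln_mono) auto
  also have "\<dots> \<le> ?L" using assms(2) ln_2_less_1 by (simp add: ln_mult)
  finally have L: "ln (1 + real T) \<le> ?L" .
  have L1: "?L \<ge> 1" using assms(2) by simp
  have dL: "?L \<le> real d * ?L" using mult_right_mono[of 1 "real d" ?L] L1 assms(1) by simp
  have "(\<Sum>t=j..<j+n. f t (?x t) - f t (pred j t)) \<le> ln (real (j + n)) / \<alpha>"
    unfolding flh_ons_play_def
  proof (rule flh_regret[OF D_convex alpha_pos assms(3)])
    show "pred i t \<in> D" if "1 \<le> i" "i \<le> t" "t < j + n" for i t
      using that assms(4) by (intro pred_mem) auto
    show "exp (- \<alpha> * f t y) \<le> exp (- \<alpha> * f t x) * (1 - \<alpha> * inn d (vdiff y x) (gr t x))"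
      if "1 \<le> t" "t < j + n" "x \<in> D" "y \<in> D" for t x y
      using that assms(4) grad f_exp_concave
      by (intro exp_concave_supporting[OF D_convex D_rspace alpha_pos]) auto
  qed
  also have "\<dots> \<le> real d * ?L / \<alpha>"
  proof (intro divide_right_mono)
    have "ln (real (j + n)) \<le> ln (1 + real T)" using assms by (intro ln_mono) auto
    then show "ln (real (j + n)) \<le> real d * ?L" using L dL by linarith
  qed (use alpha_pos in simp)
  finally have "(\<Sum>t=j..<j+n. f t (?x t) - f t (pred j t)) \<le> real d * ?L / \<alpha>" .
  moreover have "(\<Sum>t=j..<j+n. f t (pred j t) - f t u) \<le> real d * ?L / \<gamma>"
  proof -
    have "1 + real d * ln (1 + real T) \<le> 2 * (real d * ?L)"
      using mult_left_mono[OF L of_nat_0_le_iff[of d]] dL L1 by linarith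
    then have "(1 + real d * ln (1 + real T)) / (2 * \<gamma>) \<le> 2 * (real d * ?L) / (2 * \<gamma>)"
      using gamma_pos by (intro divide_right_mono) auto
    then show ?thesis using ons_regret[OF assms(3-5)] by simp
  qed
  moreover have "(1 / \<gamma> + 1 / \<alpha>) * (real d * ?L) = real d * ?L / \<gamma> + real d * ?L / \<alpha>"
    by (simp add: distrib_right)
  ultimately show ?thesis
    unfolding sum_subtractf by linarith
qed

end

subsection \<open>From adaptive to dynamic regret\<close>

text \<open>Induction on the number \<open>k\<close> of blocks, the last of which may be short.
  Arbitrary prefixes \<open>N\<close> of the horizon let all but the last block fall under the
  induction hypothesis.\<close>

lemma block_decomposition:
  fixes r p :: "nat \<Rightarrow> real"
  assumes "R \<ge> 0" "c \<ge> 0" "\<And>t. p t \<ge> 0"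
    and block: "\<And>j n. 1 \<le> j \<Longrightarrow> 1 \<le> n \<Longrightarrow> n \<le> l \<Longrightarrow> j + n \<le> Suc T \<Longrightarrow>
      (\<Sum>t=j..<j+n. r t) \<le> R + c * (\<Sum>t=Suc j..<j+n. p t)"
  shows "N \<le> T \<Longrightarrow> N \<le> k * l \<Longrightarrow> (\<Sum>t=1..<1+N. r t) \<le> real k * R + c * (\<Sum>t=2..<1+N. p t)"
proof (induction k arbitrary: N)
  case 0
  then show ?case by simp
next
  case (Suc k)
  show ?case
  proof (cases "N \<le> k * l")
    case True
    then show ?thesis using Suc.IH[OF Suc.prems(1) True] assms(1) by (simp add: algebra_simps)
  next
    case False
    define M where "M = k * l"
    have M: "M < N" "N - M \<le> l" using False Suc.prems by (auto simp: M_def)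
    have "(\<Sum>t=1..<1+N. r t) = (\<Sum>t=1..<1+M. r t) + (\<Sum>t=1+M..<1+N. r t)"
      using M by (intro sum.atLeastLessThan_concat[symmetric]) auto
    also have "(\<Sum>t=1..<1+M. r t) \<le> real k * R + c * (\<Sum>t=2..<1+M. p t)"
      using M Suc.prems by (intro Suc.IH) (auto simp: M_def)
    also have "(\<Sum>t=1+M..<1+N. r t) \<le> R + c * (\<Sum>t=2+M..<1+N. p t)"
      using block[of "1 + M" "N - M"] M Suc.prems by simp
    finally have "(\<Sum>t=1..<1+N. r t)
        \<le> real (Suc k) * R + c * ((\<Sum>t=2..<1+M. p t) + (\<Sum>t=2+M..<1+N. p t))"
      by (simp add: algebra_simps)
    also have "(\<Sum>t=2..<1+M. p t) + (\<Sum>t=2+M..<1+N. p t) = (\<Sum>t\<in>{2..<1+M} \<union> {2+M..<1+N}. p t)"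
      by (intro sum.union_disjoint[symmetric]) auto
    \<comment> \<open>The jump into the last block, at index \<open>1 + M\<close>, lies in neither
      sum; the full sum may include it because its terms are nonnegative.\<close>
    also have "\<dots> \<le> (\<Sum>t=2..<1+N. p t)"
      using M assms(3) by (intro sum_mono2) auto
    finally show ?thesis using assms(2) by (simp add: mult_left_mono)
  qed
qed

lemma vnorm_vdiff_path_length:
  "j \<le> t \<Longrightarrow> vnorm d (vdiff (z j) (z t)) \<le> (\<Sum>s=Suc j..t. vnorm d (vdiff (z s) (z (s - 1))))"
proof (induction t rule: dec_induct)
  case base
  then show ?case by (simp add: vnorm_def inn_def vdiff_def)
next
  case (step t)
  have "vnorm d (vdiff (z j) (z (Suc t))) \<le> vnorm d (vdiff (z j) (z t)) + vnorm d (vdiff (z (Suc t)) (z t))"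
    using vnorm_vdiff_triangle[of d "z j" "z (Suc t)" "z t"] by (simp add: vnorm_vdiff_commute[of d "z t"])
  then show ?case using step by simp
qed

text \<open>Each round pays at most \<open>G\<close> times the path length of the block for using
  \<open>z j\<close>. The coefficient contains \<open>l\<close> instead of \<open>n\<close> so that
  it is the same for all blocks.\<close>

lemma (in flh_ons) dynamic_regret_block:
  assumes "d \<ge> 1" "T \<ge> 1" "\<And>t. t \<in> {1..T} \<Longrightarrow> z t \<in> D" "1 \<le> j" "1 \<le> n" "n \<le> l" "j + n \<le> Suc T"
  shows "(\<Sum>t=j..<j+n. f t (flh_ons_play d D G Dd \<alpha> f gr x0 t) - f t (z t))
    \<le> (1 / \<gamma> + 1 / \<alpha>) * (real d * (1 + ln (real T)))
      + G * real l * (\<Sum>t=Suc j..<j+n. vnorm d (vdiff (z t) (z (t - 1))))"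
proof -
  let ?x = "flh_ons_play d D G Dd \<alpha> f gr x0"
  let ?V = "\<Sum>t=Suc j..<j+n. vnorm d (vdiff (z t) (z (t - 1)))"
  have "(\<Sum>t=j..<j+n. f t (z j) - f t (z t)) \<le> (\<Sum>t=j..<j+n. G * ?V)"
  proof (rule sum_mono)
    fix t assume t: "t \<in> {j..<j+n}"
    have "\<bar>f t (z j) - f t (z t)\<bar> \<le> G * vnorm d (vdiff (z j) (z t))"
      using f_lipschitz[of t] assms t by auto
    also have "\<dots> \<le> G * (\<Sum>s=Suc j..t. vnorm d (vdiff (z s) (z (s - 1))))"
      using t G_pos by (intro mult_left_mono vnorm_vdiff_path_length) auto
    also have "\<dots> \<le> G * ?V"
      using t G_pos by (intro mult_left_mono sum_mono2) (auto simp: vnorm_nonneg)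
    finally show "f t (z j) - f t (z t) \<le> G * ?V" by simp
  qed
  also have "\<dots> = G * real n * ?V" by simp
  also have "\<dots> \<le> G * real l * ?V"
    using assms(6) G_pos by (intro mult_right_mono mult_left_mono sum_nonneg) (auto simp: vnorm_nonneg)
  finally have "(\<Sum>t=j..<j+n. f t (z j) - f t (z t)) \<le> G * real l * ?V" .
  moreover have "(\<Sum>t=j..<j+n. f t (?x t) - f t (z j)) \<le> (1 / \<gamma> + 1 / \<alpha>) * (real d * (1 + ln (real T)))"
    using assms by (intro adaptive_regret) auto
  ultimately show ?thesis by (simp add: sum_subtractf)
qed

text \<open>Blocks of length about \<open>sqrt (d T / V)\<close> balance the two error terms.\<close>

lemma (in flh_ons) dynamic_regret:
  assumes "d \<ge> 1" "T \<ge> 1" "\<And>t. t \<in> {1..T} \<Longrightarrow> z t \<in> D"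
  defines "V \<equiv> \<Sum>t=2..T. vnorm d (vdiff (z t) (z (t - 1)))"
  shows "(\<Sum>t=1..T. f t (flh_ons_play d D G Dd \<alpha> f gr x0 t) - f t (z t))
    \<le> (2 * (1 / \<gamma> + 1 / \<alpha>) + G * (1 + sqrt Dd)) * (1 + ln (real T))
        * max (sqrt (real d * real T * V)) (real d)"
proof -
  define K where "K = 1 / \<gamma> + 1 / \<alpha>"
  define L where "L = 1 + ln (real T)"
  define S where "S = sqrt (real d * real T * V)"
  define M where "M = max S (real d)"
  let ?r = "\<lambda>t. f t (flh_ons_play d D G Dd \<alpha> f gr x0 t) - f t (z t)"
  have K: "K \<ge> 0" using gamma_pos alpha_pos by (simp add: K_def)
  have L: "L \<ge> 1" using assms(2) by (simp add: L_def)
  have V: "V \<ge> 0" by (simp add: V_def sum_nonneg vnorm_nonneg)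
  have M: "S \<le> M" "real d \<le> M" "M \<ge> 0" using assms(1) by (auto simp: M_def)
  have blocks: "(\<Sum>t=1..T. ?r t) \<le> real k * (K * (real d * L)) + G * real l * V" if "T \<le> k * l" for k l
  proof -
    have "(\<Sum>t=1..<1+T. ?r t) \<le> real k * (K * (real d * L))
        + G * real l * (\<Sum>t=2..<1+T. vnorm d (vdiff (z t) (z (t - 1))))"
    proof (rule block_decomposition[where l = l and T = T])
      show "0 \<le> K * (real d * L)" using K L by simp
      show "0 \<le> G * real l" using G_pos by simp
      show "(\<Sum>t=j..<j+n. ?r t) \<le> K * (real d * L)
          + G * real l * (\<Sum>t=Suc j..<j+n. vnorm d (vdiff (z t) (z (t - 1))))"
        if "1 \<le> j" "1 \<le> n" "n \<le> l" "j + n \<le> Suc T" for j n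
        unfolding K_def L_def using assms that by (intro dynamic_regret_block) auto
    qed (use that in \<open>auto simp: vnorm_nonneg\<close>)
    then show ?thesis by (simp add: V_def atLeastLessThanSuc_atLeastAtMost)
  qed
  have "(\<Sum>t=1..T. ?r t) \<le> (2 * K + G * (1 + sqrt Dd)) * L * M"
  proof (cases "V = 0")
    case True
    \<comment> \<open>Without movement the block length chosen below would divide by 0; one block
      covering all rounds is enough.\<close>
    have "(\<Sum>t=1..T. ?r t) \<le> K * (real d * L)" using blocks[of 1 T] True by simp
    also have "\<dots> \<le> K * (M * L)" using K L M by (intro mult_left_mono mult_right_mono) auto
    also have "\<dots> \<le> (2 * K + G * (1 + sqrt Dd)) * (M * L)"
      using K L M G_pos Dd_pos by (intro mult_right_mono) auto
    finally show ?thesis by (simp add: ac_simps)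
  next
    case False
    then have Vpos: "V > 0" using V by simp
    \<comment> \<open>With this length both \<open>real T / s * real d\<close> and
      \<open>s * V\<close> equal \<open>S\<close>.\<close>
    define s where "s = sqrt (real T * real d / V)"
    have s: "s > 0" using assms(1,2) Vpos by (simp add: s_def)
    define l where "l = nat \<lfloor>s\<rfloor> + 1"
    have l: "s \<le> real l" "real l \<le> s + 1" using s by (auto simp: l_def) linarith+
    \<comment> \<open>The additional block for the remainder costs one more \<open>real d\<close>,
      which the maximum in \<open>M\<close> covers.\<close>
    have "T \<le> (T div l + 1) * l"
      using dividend_less_div_times[of l T] by (simp add: l_def)
    then have "(\<Sum>t=1..T. ?r t) \<le> real (T div l + 1) * (K * (real d * L)) + G * real l * V"
      by (rule blocks)
    also have "real (T div l + 1) * (K * (real d * L)) \<le> 2 * K * L * M"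
    proof -
      have "real (T div l) \<le> real T / real l" by (rule of_nat_div_le_of_nat)
      also have "\<dots> \<le> real T / s" using l s by (intro divide_left_mono) auto
      finally have "real (T div l) * real d \<le> real T / s * real d" by (intro mult_right_mono) auto
      also have "real T / s * real d = S"
      proof -
        have "S * s = real T * real d"
        proof -
          have "(real d * real T * V) * (real T * real d / V) = (real T * real d)\<^sup>2"
            using Vpos by (simp add: power2_eq_square)
          then show ?thesis unfolding S_def s_def real_sqrt_mult[symmetric] by simp
        qed
        then show ?thesis using s by (simp add: field_simps)
      qed
      finally have "real (T div l + 1) * real d \<le> 2 * M" using M by (simp add: algebra_simps)
      then have "(real (T div l + 1) * real d) * (K * L) \<le> 2 * M * (K * L)"
        using K L by (intro mult_right_mono) auto
      then show ?thesis by (simp add: ac_simps)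
    qed
    also have "G * real l * V \<le> G * (1 + sqrt Dd) * L * M"
    proof -
      \<comment> \<open>Rounding \<open>s\<close> up costs at most an additional \<open>V\<close>.
        Since the diameter gives \<open>V \<le> T * Dd\<close>, this is at most
        \<open>sqrt Dd * S\<close>.\<close>
      have "z t \<in> D" "z (t - 1) \<in> D" if "t \<in> {2..T}" for t
        using that by (intro assms(3), force, intro assms(3), force)
      then have "V \<le> (\<Sum>t=2..T. Dd)"
        unfolding V_def by (intro sum_mono D_diam[rule_format])
      also have "\<dots> \<le> real T * Dd" using Dd_pos by (simp add: mult_right_mono)
      finally have "V * V \<le> (real T * Dd) * V" using V by (intro mult_right_mono)
      also have "\<dots> \<le> real d * ((real T * Dd) * V)"
        using assms(1) V Dd_pos mult_right_mono[of 1 "real d" "(real T * Dd) * V"] by simp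
      also have "\<dots> = Dd * (real d * real T * V)" by simp
      finally have "sqrt (V * V) \<le> sqrt (Dd * (real d * real T * V))"
        by (rule real_sqrt_le_mono)
      then have "V \<le> sqrt Dd * S" using V by (simp add: S_def real_sqrt_mult)
      moreover have "s * V = S"
      proof -
        have "s * V = sqrt (real T * real d / V) * sqrt (V * V)" using V by (simp add: s_def)
        also have "\<dots> = S" unfolding S_def real_sqrt_mult[symmetric] using Vpos by (simp add: ac_simps)
        finally show ?thesis .
      qed
      moreover have "real l * V \<le> (s + 1) * V" using l V by (intro mult_right_mono)
      ultimately have "real l * V \<le> (1 + sqrt Dd) * S" by (simp add: algebra_simps)
      also have "\<dots> \<le> (1 + sqrt Dd) * (L * M)"
        using M L Dd_pos mult_right_mono[of 1 L M] by (intro mult_left_mono) auto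
      finally have "G * (real l * V) \<le> G * ((1 + sqrt Dd) * (L * M))"
        using G_pos by (intro mult_left_mono) auto
      then show ?thesis by (simp add: ac_simps)
    qed
    finally show ?thesis by (simp add: algebra_simps)
  qed
  then show ?thesis by (simp add: K_def L_def M_def S_def)
qed

text \<open>The constant depends on \<open>G\<close>, \<open>Dd\<close> and \<open>\<alpha>\<close>
  only, and one logarithmic factor suffices. \<open>flh_ons_play\<close> receives neither the
  comparators nor their path length.\<close>

theorem theorem7:
  fixes G Dd \<alpha> :: real
  assumes "G > 0" and "Dd > 0" and "\<alpha> > 0"
  shows "\<exists>C::real. \<exists>k::nat. \<forall>(d::nat) (T::nat) (D::vect set) (f::nat \<Rightarrow> vect \<Rightarrow> real)
            (gr::nat \<Rightarrow> vect \<Rightarrow> vect) (z::nat \<Rightarrow> vect) (x0::nat \<Rightarrow> vect).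
     d \<ge> 1 \<and> T \<ge> 1 \<and> D \<subseteq> rspace d \<and> D \<noteq> {} \<and> convex_set D \<and> closed D
     \<and> (\<forall>x\<in>D. \<forall>y\<in>D. vnorm d (vdiff x y) \<le> Dd)
     \<and> (\<forall>t\<in>{1..T}. (\<forall>x\<in>D. has_grad d (f t) (gr t x) x)
                    \<and> exp_concave d \<alpha> D (f t) (gr t)
                    \<and> (\<forall>x\<in>D. \<forall>y\<in>D. \<bar>f t x - f t y\<bar> \<le> G * vnorm d (vdiff x y)))
     \<and> (\<forall>t\<in>{1..T}. z t \<in> D)
     \<and> (\<forall>j. x0 j \<in> D)
     \<longrightarrow> (\<Sum>t=1..T. f t (flh_ons_play d D G Dd \<alpha> f gr x0 t) - f t (z t))
         \<le> C * (1 + ln (real T)) ^ k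
             * max (sqrt (real d * real T * (\<Sum>t=2..T. vnorm d (vdiff (z t) (z (t - 1)))))) (real d)"
proof (intro exI[of _ "2 * (1 / ons_gamma G Dd \<alpha> + 1 / \<alpha>) + G * (1 + sqrt Dd)"] exI[of _ "1::nat"]
    allI impI, elim conjE)
  fix d T :: nat and D :: "vect set" and f :: "nat \<Rightarrow> vect \<Rightarrow> real" and gr :: "nat \<Rightarrow> vect \<Rightarrow> vect"
    and z x0 :: "nat \<Rightarrow> vect"
  assume *: "d \<ge> 1" "T \<ge> 1" "D \<subseteq> rspace d" "D \<noteq> {}" "convex_set D" "closed D"
    "\<forall>x\<in>D. \<forall>y\<in>D. vnorm d (vdiff x y) \<le> Dd"
    "\<forall>t\<in>{1..T}. (\<forall>x\<in>D. has_grad d (f t) (gr t x) x)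
        \<and> exp_concave d \<alpha> D (f t) (gr t)
        \<and> (\<forall>x\<in>D. \<forall>y\<in>D. \<bar>f t x - f t y\<bar> \<le> G * vnorm d (vdiff x y))"
    "\<forall>t\<in>{1..T}. z t \<in> D" "\<forall>j. x0 j \<in> D"
  interpret flh_ons d T D f gr x0 G Dd \<alpha>
    by unfold_locales (use assms * in auto)
  show "(\<Sum>t=1..T. f t (flh_ons_play d D G Dd \<alpha> f gr x0 t) - f t (z t))
      \<le> (2 * (1 / ons_gamma G Dd \<alpha> + 1 / \<alpha>) + G * (1 + sqrt Dd)) * (1 + ln (real T)) ^ 1
        * max (sqrt (real d * real T * (\<Sum>t=2..T. vnorm d (vdiff (z t) (z (t - 1)))))) (real d)"
    using dynamic_regret[of z] * by simp
qed

end
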